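(* Let $d\ge3$, $\beta>0$, $\alpha\le0$, $a>0$ and $0<b<\min\big\{a,(\beta q_1^{(\alpha)})^{-1}e^{-\beta\mu_{\rm p}/a}\big\}$. If $d\ge5$, suppose also that $$\lim_{x\uparrow0}\tilde h'(x)>1$$ (equivalently, $\lim_{\delta\uparrow\mu/a}(g^0)'(\delta)>1$ for $\mu\le\mu_{\rm p}$). Then there exists a unique $\mu^*\in(\mu_{\rm tang},\mu_{\rm p})$ such that $F_\mu$ has a unique minimiser over $\ell_1(\mathbb R_+)$ for every $\mu<\mu^*$ and for every $\mu>\mu^*$, and two simultaneous minimisers at $\mu=\mu^*$. In particular, the function $\mu\mapsto\inf_{\ell_1(\mathbb R_+)}F_\mu$ is differentiable on $(-\infty,\mu^* )\cup(\mu^*,\infty)$, and not on any open neighbourhood of $\mu^*$. The densities of the two simultaneous minimisers $\xi^1(\mu^* )$ and $\xi^2(\mu^* )$ satisfy $D(\xi^1(\mu^* ))>\mu^*/a>D(\xi^2(\mu^* ))$.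
   Context: $q_k^{(\alpha)}=\frac{e^{\beta k\alpha}}{(4\pi\beta)^{d/2}k^{1+d/2}}$ for $k\in\mathbb N=\{1,2,\dots\}$, $\bar q^{(\alpha)}=\sum_kq_k^{(\alpha)}$; $\ell_1(\mathbb R_+)$ is the space of nonnegative summable sequences. $D(x)=\sum_{k\ge1}kx_k\in[0,\infty]$, $(t)_+=\max\{t,0\}$, $$I_\alpha(x)=\sum_{k=1}^\infty\frac{x_k}\beta\Big(\log\frac{x_k}{q_k^{(\alpha)}}-1\Big)+\frac{\bar q^{(\alpha)}}\beta\quad(0\log0=0),\qquad H^{\mathrm{HYL}}_\mu(x)=-\mu D(x)+\frac a2D(x)^2-\frac b2\sum_{k=1}^\infty k^2x_k^2,$$ $$F_\mu(x)=I_\alpha(x)+H^{\mathrm{HYL}}_\mu(x)-\frac1{2(a-b)}\big(\mu-aD(x)\big)_+^2,$$ with $F_\mu(x)=+\infty$ if $D(x)=\infty$. $W_0:[-e^{-1},\infty)\to[-1,\infty)$ is the principal real branch of the Lambert function (inverse of $w\mapsto we^w$). For $x\le0$ define $$\tilde h(x)=-\frac1{b\beta}\sum_{k=1}^\infty\frac1kW_0\Big(-b\beta k^2q_k^{(\alpha)}\exp\Big(\frac{ab}{a-b}\beta kx\Big)\Big),\qquad \mu_{\rm p}=a\,\tilde h(0),\qquad \mu_{\rm tang}=a\inf_{x\le0}\{\tilde h(x)-x\}.$$ It is a standing assumption that all arguments of $W_0$ lie in $[-e^{-1},0)$, i.e. $b\le\frac1{e\beta q_1^{(\alpha)}}$,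 so that $\tilde h$ and $\mu_{\rm p}$ are defined; note that $\mu_{\rm p}$ depends on $b$. The function $g^0$ (depending on $\mu$) is $$g^0(\delta)=-\frac1{b\beta}\sum_{k=1}^\infty\frac1kW_0\big(-b\beta k^2q_k^{(\alpha)}e^{E_k(\delta)}\big),\qquad E_k(\delta)=\begin{cases}\beta k(\mu-a\delta),&a\delta\ge\mu,\\-\frac b{a-b}\beta k(\mu-a\delta),&a\delta\le\mu,\end{cases}$$ so that $g^0(\delta)=\tilde h(\delta-\mu/a)$ for $\delta\le\mu/a$.
   Formalization: The condition that the limit of h̃'(x) as x↑0 exceeds 1 is required also for d=3,4 when α<0 (not only for d≥5), since otherwise μ_tang=μ_p can occur and the interval is empty, e.g. d=3, β=a=1, b=1/2, α=−10. *)

theory Defs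
  imports "HOL-Analysis.Analysis"
begin

text \<open>
  Sequences \<open>(x\<^sub>k)\<close> with \<open>k = 1, 2, \<dots>\<close> are functions \<open>x :: nat \<Rightarrow> real\<close> whose unused entry \<open>x 0\<close> is
  pinned to \<open>0\<close> in \<open>l1_plus\<close>, so that each sequence has exactly one representative. Sums over
  \<open>k \<ge> 1\<close> are written as \<open>\<Sum>k. f (Suc k)\<close>.
\<close>

definition l1_plus :: "(nat \<Rightarrow> real) set" where
  "l1_plus = {x. x 0 = 0 \<and> (\<forall>k. 0 \<le> x k) \<and> summable x}"

definition lambert_W0 :: "real \<Rightarrow> real" where
  "lambert_W0 = the_inv_into {-1..} (\<lambda>w. w * exp w)"

definition q :: "nat \<Rightarrow> real \<Rightarrow> real \<Rightarrow> nat \<Rightarrow> real" where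
  "q d \<beta> \<alpha> k = exp (\<beta> * real k * \<alpha>)
     / ((4 * pi * \<beta>) powr (real d / 2) * real k powr (1 + real d / 2))"

definition q_bar :: "nat \<Rightarrow> real \<Rightarrow> real \<Rightarrow> real" where
  "q_bar d \<beta> \<alpha> = (\<Sum>k. q d \<beta> \<alpha> (Suc k))"

definition total_density :: "(nat \<Rightarrow> real) \<Rightarrow> ereal" where
  "total_density x = (\<Sum>k. ereal (real (Suc k) * x (Suc k)))"

text \<open>
  The partial sums below converge in the extended reals for every \<open>x\<close> in \<open>l1_plus\<close>, because
  \<open>t * (ln (t / r) - 1) \<ge> - r\<close> for \<open>t \<ge> 0\<close>, \<open>r > 0\<close>, and \<open>q\<close> is summable. The
  convention \<open>0 * log 0 = 0\<close> holds automatically.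
\<close>

definition rate_I :: "nat \<Rightarrow> real \<Rightarrow> real \<Rightarrow> (nat \<Rightarrow> real) \<Rightarrow> ereal" where
  "rate_I d \<beta> \<alpha> x =
     (\<Sum>k. ereal (x (Suc k) / \<beta> * (ln (x (Suc k) / q d \<beta> \<alpha> (Suc k)) - 1)))
     + ereal (q_bar d \<beta> \<alpha> / \<beta>)"

text \<open>
  \<open>H_HYL\<close> is only used where \<open>total_density x\<close> is finite; there the series of squares converges, being
  bounded by the square of the density.
\<close>

definition H_HYL :: "real \<Rightarrow> real \<Rightarrow> real \<Rightarrow> (nat \<Rightarrow> real) \<Rightarrow> real" where
  "H_HYL a b \<mu> x =
     - \<mu> * real_of_ereal (total_density x) + a / 2 * (real_of_ereal (total_density x))\<^sup>2
     - b / 2 * (\<Sum>k. (real (Suc k))\<^sup>2 * (x (Suc k))\<^sup>2)"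

definition F :: "nat \<Rightarrow> real \<Rightarrow> real \<Rightarrow> real \<Rightarrow> real \<Rightarrow> real \<Rightarrow> (nat \<Rightarrow> real) \<Rightarrow> ereal" where
  "F d \<beta> \<alpha> a b \<mu> x =
     (if total_density x = \<infinity> then \<infinity>
      else rate_I d \<beta> \<alpha> x + ereal (H_HYL a b \<mu> x)
           - ereal (1 / (2 * (a - b)) * (max (\<mu> - a * real_of_ereal (total_density x)) 0)\<^sup>2))"

definition minimisers ::
    "nat \<Rightarrow> real \<Rightarrow> real \<Rightarrow> real \<Rightarrow> real \<Rightarrow> real \<Rightarrow> (nat \<Rightarrow> real) set" where
  "minimisers d \<beta> \<alpha> a b \<mu> = {x. is_arg_min (F d \<beta> \<alpha> a b \<mu>) (\<lambda>y. y \<in> l1_plus) x}"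

definition h_tilde :: "nat \<Rightarrow> real \<Rightarrow> real \<Rightarrow> real \<Rightarrow> real \<Rightarrow> real \<Rightarrow> real" where
  "h_tilde d \<beta> \<alpha> a b x =
     - (1 / (b * \<beta>)) *
       (\<Sum>k. 1 / real (Suc k) *
          lambert_W0 (- b * \<beta> * (real (Suc k))\<^sup>2 * q d \<beta> \<alpha> (Suc k)
                      * exp (a * b / (a - b) * \<beta> * real (Suc k) * x)))"

definition mu_p :: "nat \<Rightarrow> real \<Rightarrow> real \<Rightarrow> real \<Rightarrow> real \<Rightarrow> real" where
  "mu_p d \<beta> \<alpha> a b = a * h_tilde d \<beta> \<alpha> a b 0"

definition mu_tang :: "nat \<Rightarrow> real \<Rightarrow> real \<Rightarrow> real \<Rightarrow> real \<Rightarrow> real" where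
  "mu_tang d \<beta> \<alpha> a b = a * (INF x\<in>{..0}. h_tilde d \<beta> \<alpha> a b x - x)"

definition E :: "real \<Rightarrow> real \<Rightarrow> real \<Rightarrow> real \<Rightarrow> nat \<Rightarrow> real \<Rightarrow> real" where
  "E \<beta> a b \<mu> k \<delta> =
     (if a * \<delta> \<ge> \<mu> then \<beta> * real k * (\<mu> - a * \<delta>)
      else - (b / (a - b)) * \<beta> * real k * (\<mu> - a * \<delta>))"

definition g0 :: "nat \<Rightarrow> real \<Rightarrow> real \<Rightarrow> real \<Rightarrow> real \<Rightarrow> real \<Rightarrow> real \<Rightarrow> real" where
  "g0 d \<beta> \<alpha> a b \<mu> \<delta> =
     - (1 / (b * \<beta>)) *
       (\<Sum>k. 1 / real (Suc k) *
          lambert_W0 (- b * \<beta> * (real (Suc k))\<^sup>2 * q d \<beta> \<alpha> (Suc k)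
                      * exp (E \<beta> a b \<mu> (Suc k) \<delta>)))"

text \<open>
  The left limit of the derivative at \<open>c\<close> exists in the extended reals and exceeds 1. The value
  infinity must be admitted: for \<open>h_tilde\<close> at \<open>0\<close> it occurs when \<open>\<alpha> = 0\<close> and \<open>d \<le> 4\<close>, and in every
  dimension when \<open>b = 1 / (e * \<beta> * q\<^sub>1)\<close>, where \<open>lambert_W0\<close> reaches its branch point.
  When \<open>\<alpha> < 0\<close> the limit can be at most 1 also for \<open>d = 3, 4\<close>; then, \<open>h_tilde\<close> being convex,
  \<open>mu_tang = mu_p\<close> and there is no \<open>\<mu>\<close> strictly between them.
\<close>

definition left_slope_gt_one :: "(real \<Rightarrow> real) \<Rightarrow> real \<Rightarrow> bool" where
  "left_slope_gt_one f c \<longleftrightarrow>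
     (\<exists>L::ereal. ((\<lambda>x. ereal (deriv f x)) \<longlongrightarrow> L) (at_left c) \<and> L > 1)"

definition single_transition_at ::
    "nat \<Rightarrow> real \<Rightarrow> real \<Rightarrow> real \<Rightarrow> real \<Rightarrow> real \<Rightarrow> bool" where
  "single_transition_at d \<beta> \<alpha> a b \<mu>s \<longleftrightarrow>
     (\<forall>\<mu><\<mu>s. \<exists>!x. x \<in> minimisers d \<beta> \<alpha> a b \<mu>) \<and>
     (\<forall>\<mu>>\<mu>s. \<exists>!x. x \<in> minimisers d \<beta> \<alpha> a b \<mu>) \<and>
     card (minimisers d \<beta> \<alpha> a b \<mu>s) = 2"

end

theory Submission
  imports Defs
begin

text \<open>
  The functional splits as \<open>F \<mu> x = e x + mean_field a b \<mu> (D x)\<close>: the part \<open>e\<close> collects, cycle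
  length by cycle length, the entropy and the negative quadratic term, and the rest depends on the
  density \<open>D x\<close> only. With \<open>c = a b / (a - b)\<close>, the mean-field part is, up to the constant
  \<open>- \<mu>\<^sup>2 / (2 a)\<close>, the convex parabola \<open>a / 2 (\<delta> - \<mu> / a)\<^sup>2\<close> to the right of \<open>\<mu> / a\<close> and the
  concave parabola \<open>- c / 2 (\<delta> - \<mu> / a)\<^sup>2\<close> to the left of it. It is the least value over
  \<open>m \<ge> 0\<close> of \<open>- \<mu> (\<delta> + m) + a / 2 (\<delta> + m)\<^sup>2 - b / 2 m\<^sup>2\<close>, where \<open>m\<close> is the density of a
  condensate of infinitely long cycles. The proof has three steps.

  Truncation. The cost of an entry is concave where \<open>b \<beta> k\<^sup>2 x\<^sub>k > 1\<close>. Mass \<open>t\<close> taken out of the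
  sequence can be moved to the condensate, so the mean-field part drops by at least \<open>b / 2 t\<^sup>2\<close>
  (\<open>mean_field_remove\<close>). This outweighs what the quadratic term loses, and the remaining cost of such
  entries is positive because \<open>e b \<beta> k\<^sup>2 q\<^sub>k \<le> 1\<close>. So setting all of them to \<open>0\<close> strictly lowers
  \<open>F\<close> (\<open>trunc_improves\<close>).

  Duality in the box \<open>b \<beta> k\<^sup>2 x\<^sub>k \<le> 1\<close>. There \<open>e x + s D x\<close> is a sum of strictly convex functions
  of one variable, and for \<open>s \<ge> 0\<close> its unique minimiser \<open>\<xi> s\<close> is given entrywise by the principal
  Lambert branch (\<open>e_ge_\<Psi>\<close>). Its density is \<open>N s\<close>, which is \<open>h_tilde\<close> at \<open>- s / c\<close>. The minimal
  value \<open>\<Psi> s\<close> is concave with derivative \<open>N s\<close>. From here on only \<open>N\<close> and \<open>\<Psi>\<close> matter: \<open>N\<close> is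
  continuous, strictly decreasing and strictly convex, because the tree function is strictly convex
  in the logarithm of its argument.

  Two wells. Stationary points of density at least \<open>\<mu> / a\<close> are the solutions of \<open>R s = \<mu>\<close> with
  \<open>R s = a N s - s\<close>; those of density at most \<open>\<mu> / a\<close> solve \<open>L s = \<mu>\<close> with
  \<open>L s = a N s + (a - b) / b s\<close>. The function \<open>R\<close> decreases from \<open>\<mu>\<^sub>p\<close>, so it gives one candidate
  for each \<open>\<mu> \<le> \<mu>\<^sub>p\<close>. The function \<open>L\<close> is strictly convex with \<open>L 0 = \<mu>\<^sub>p\<close> and least value
  \<open>\<mu>\<^sub>tang\<close>, so its increasing branch gives one candidate for each \<open>\<mu> \<ge> \<mu>\<^sub>tang\<close>. The slope condition
  gives values of \<open>L\<close> below \<open>L 0\<close>, that is \<open>\<mu>\<^sub>tang < \<mu>\<^sub>p\<close> (\<open>steep_of_left_slope\<close>); for \<open>\<alpha> = 0\<close> and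
  \<open>d \<le> 4\<close> the slope is infinite, so such values exist anyway (\<open>steep_of_low_dimension\<close>). No other point competes
  (\<open>two_well_bound\<close>). By the envelope theorem the values of the candidates have the derivatives
  \<open>- (s_R \<mu> + \<mu>) / a\<close> and \<open>- (s_L \<mu> + \<mu>) / a\<close>, and \<open>s_R \<mu> < s_L \<mu>\<close>. So their difference is strictly
  increasing; it is negative at \<open>\<mu>\<^sub>tang\<close>, where the left candidate is only an inflection point, and
  positive at \<open>\<mu>\<^sub>p\<close>, where the right candidate has density \<open>\<mu> / a\<close> and lies on the slope down to
  the left well. It vanishes exactly once. At that point both candidates
  are minimisers, and the two one-sided derivatives of the least value differ.
\<close>

section \<open>Envelopes and inverse functions on the line\<close>

text \<open>
  The envelope theorem in the form used for every value function below: if each point carries an affine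
  upper bound and its slope depends continuously on the point, then the slope is the derivative. Both
  \<open>t x\<close> and \<open>t y\<close> bound the difference quotient between \<open>x\<close> and \<open>y\<close>, from opposite sides.
\<close>

lemma supergradient_imp_derivative:
  fixes g t :: "real \<Rightarrow> real"
  assumes super: "\<And>x y. x \<in> S \<Longrightarrow> y \<in> S \<Longrightarrow> g y \<le> g x + (y - x) * t x"
    and cont: "continuous_on S t" and x: "x \<in> S"
  shows "(g has_field_derivative t x) (at x within S)"
  unfolding has_field_derivative_iff
proof (rule Lim_transform2)
  show "(t \<longlongrightarrow> t x) (at x within S)"
    using cont x by (simp add: continuous_on)
  have lim: "((\<lambda>y. \<bar>t y - t x\<bar>) \<longlongrightarrow> 0) (at x within S)"
    using cont x by (metis (no_types) LIM_zero continuous_on tendsto_rabs_zero)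
  have "\<bar>t y - (g y - g x) / (y - x)\<bar> \<le> \<bar>t y - t x\<bar>" if "y \<in> S" "y \<noteq> x" for y
  proof -
    have 1: "(y - x) * t y \<le> g y - g x" and 2: "g y - g x \<le> (y - x) * t x"
      using super[OF x that(1)] super[OF that(1) x] by (auto simp: algebra_simps)
    show ?thesis
    proof (cases "x < y")
      case True
      then have "t y \<le> (g y - g x) / (y - x)" "(g y - g x) / (y - x) \<le> t x"
        using 1 2 by (auto simp: field_simps)
      then show ?thesis by linarith
    next
      case False
      then have "x > y" using that by simp
      then have "(g y - g x) / (y - x) \<le> t y" "t x \<le> (g y - g x) / (y - x)"
        using 1 2 by (auto simp: field_simps)
      then show ?thesis by linarith
    qed
  qed
  then have "\<forall>\<^sub>F y in at x within S. \<bar>t y - (g y - g x) / (y - x)\<bar> \<le> \<bar>t y - t x\<bar>"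
    by (auto simp: eventually_at intro!: exI[of _ 1])
  then have "\<forall>\<^sub>F y in at x within S. norm (t y - (g y - g x) / (y - x)) \<le> \<bar>t y - t x\<bar>"
    by simp
  then show "((\<lambda>y. t y - (g y - g x) / (y - x)) \<longlongrightarrow> 0) (at x within S)"
    using lim by (rule Lim_null_comparison)
qed

text \<open>
  Locally the inverse is the inverse of a continuous injection on a compact interval. The closed
  endpoint is included, because the value functions are compared up to the ends of their domains.
\<close>

lemma continuous_on_inverse_half_line:
  fixes f g :: "real \<Rightarrow> real"
  assumes cont: "continuous_on {l..} f" and mono: "\<And>s t. l \<le> s \<Longrightarrow> s < t \<Longrightarrow> f s < f t"
    and inv: "\<And>y. f l \<le> y \<Longrightarrow> l \<le> g y \<and> f (g y) = y"
  shows "continuous_on {f l..} g"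
proof -
  have inj: "s = t" if "l \<le> s" "l \<le> t" "f s = f t" for s t
    using mono[of s t] mono[of t s] that by (cases s t rule: linorder_cases) auto
  have "continuous (at y within {f l..}) g" if y: "f l \<le> y" for y
  proof -
    define S where "S = g (y + 1)"
    have S: "l \<le> S" "f S = y + 1" using inv[of "y+1"] y by (auto simp: S_def)
    have gf: "g (f s) = s" if "l \<le> s" for s
    proof -
      have "f l \<le> f s" using mono[of l s] that by (cases "l = s") auto
      then show ?thesis using inj inv that by blast
    qed
    have "continuous_on (f ` {l..S}) g"
    proof (rule continuous_on_inv)
      show "continuous_on {l..S} f" using cont by (rule continuous_on_subset) auto
      show "compact {l..S}" by simp
      show "\<forall>x\<in>{l..S}. g (f x) = x" using gf by auto
    qed
    moreover have "{f l..y+1} \<subseteq> f ` {l..S}"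
    proof
      fix z assume z: "z \<in> {f l..y+1}"
      then have "l \<le> g z" "f (g z) = z" using inv[of z] by auto
      moreover have "g z \<le> S"
        using mono[of S "g z"] S z \<open>f (g z) = z\<close> by (cases "g z \<le> S") auto
      ultimately show "z \<in> f ` {l..S}" by force
    qed
    ultimately have "continuous_on {f l..y+1} g" by (rule continuous_on_subset)
    then have "continuous (at y within {f l..y+1}) g" using y by (simp add: continuous_on_eq_continuous_within)
    moreover have "at y within {f l..y+1} = at y within {f l..}"
      by (rule at_within_nhd[of _ "{..<y+1}"]) auto
    ultimately show ?thesis by simp
  qed
  then show ?thesis by (simp add: continuous_on_eq_continuous_within)
qed

section \<open>The mean-field energy as a function of the density\<close>

definition mean_field :: "real \<Rightarrow> real \<Rightarrow> real \<Rightarrow> real \<Rightarrow> real" where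
  "mean_field a b \<mu> \<delta> = - \<mu> * \<delta> + a / 2 * \<delta>\<^sup>2 - 1 / (2 * (a - b)) * (max (\<mu> - a * \<delta>) 0)\<^sup>2"

text \<open>
  Any \<open>m \<ge> 0\<close> is a competitor in the minimum over condensate densities that defines the left-hand
  value. With \<open>p\<close> the optimal condensate density at \<open>\<delta>\<close>, the choice \<open>m = p + t\<close> moves the removed
  mass \<open>t\<close> into the condensate: the total density stays the same, and \<open>- b / 2 m\<^sup>2\<close> gains at least
  \<open>b / 2 t\<^sup>2\<close>.
\<close>

lemma mean_field_remove:
  assumes "0 < b" "b < a" "0 \<le> t"
  shows "mean_field a b \<mu> (\<delta> - t) + b / 2 * t\<^sup>2 \<le> mean_field a b \<mu> \<delta>"
proof -
  define p where "p = max (\<mu> - a * \<delta>) 0 / (a - b)"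
  define u where "u = \<mu> - a * (\<delta> - t)"
  define V where "V x = - \<mu> * x + a / 2 * x\<^sup>2" for x
  have p: "0 \<le> p" "max (\<mu> - a * \<delta>) 0 = (a - b) * p" using assms by (auto simp: p_def)
  \<comment> \<open>The condensate density \<open>m\<close> as one competitor in the minimum: Young inequality.\<close>
  have young: "- ((max u 0)\<^sup>2 / (2 * (a - b))) \<le> - u * m + (a - b) / 2 * m\<^sup>2" if "0 \<le> m" for m
  proof -
    have "0 \<le> (max u 0 - (a - b) * m)\<^sup>2 / (2 * (a - b))" using assms by simp
    also have "\<dots> = (max u 0)\<^sup>2 / (2 * (a - b)) - max u 0 * m + (a - b) / 2 * m\<^sup>2"
      using assms by (simp add: field_simps power2_eq_square)
    finally show ?thesis using mult_right_mono[of u "max u 0" m] that by simp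
  qed
  have "mean_field a b \<mu> (\<delta> - t) = V (\<delta> - t) - (max u 0)\<^sup>2 / (2 * (a - b))"
    by (simp add: mean_field_def V_def u_def)
  also have "\<dots> \<le> V (\<delta> - t) - u * (p + t) + (a - b) / 2 * (p + t)\<^sup>2"
    using young[of "p + t"] p(1) assms(3) by simp
  also have "\<dots> = V \<delta> - (\<mu> - a * \<delta>) * p + (a - b) / 2 * p\<^sup>2 - b * t * p - b / 2 * t\<^sup>2"
    by (simp add: V_def u_def power2_eq_square algebra_simps add_divide_distrib diff_divide_distrib)
  also have "(\<mu> - a * \<delta>) * p = (a - b) * p\<^sup>2"
    using p assms by (cases "p = 0") (auto simp: max_def power2_eq_square split: if_splits)
  finally have "mean_field a b \<mu> (\<delta> - t) \<le> V \<delta> - (a - b) / 2 * p\<^sup>2 - b * t * p - b / 2 * t\<^sup>2"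
    by simp
  moreover have "mean_field a b \<mu> \<delta> = V \<delta> - (a - b) / 2 * p\<^sup>2"
  proof -
    have "1 / (2 * c) * (c * p)\<^sup>2 = c / 2 * p\<^sup>2" if "c \<noteq> 0" for c
      using that by (simp add: power2_eq_square)
    from this[of "a - b"] show ?thesis
      unfolding mean_field_def p(2) V_def using assms by simp
  qed
  moreover have "0 \<le> b * t * p" using assms p by simp
  ultimately show ?thesis by simp
qed

section \<open>The two wells of a density curve\<close>

text \<open>
  \<open>N s\<close> stands for the density of the minimiser of \<open>e + s D\<close> and \<open>\<Psi> s\<close> for the minimal value. The
  last assumption is the slope condition in integrated form: it survives an infinite slope at \<open>0\<close> and
  mentions no derivative. It reads \<open>L s < L 0\<close> for some \<open>s > 0\<close>.
\<close>

locale density_curve =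
  fixes a b :: real and N \<Psi> :: "real \<Rightarrow> real"
  assumes b_pos: "0 < b" and b_less_a: "b < a"
    and N_cont: "continuous_on {0..} N"
    and N_nonneg: "\<And>s. 0 \<le> s \<Longrightarrow> 0 \<le> N s"
    and N_less: "\<And>s t. 0 \<le> s \<Longrightarrow> s < t \<Longrightarrow> N t < N s"
    and N_strictly_convex: "\<And>s t l. 0 \<le> s \<Longrightarrow> s < t \<Longrightarrow> 0 < l \<Longrightarrow> l < 1 \<Longrightarrow>
          N ((1 - l) * s + l * t) < (1 - l) * N s + l * N t"
    and \<Psi>_supergradient: "\<And>s t. 0 \<le> s \<Longrightarrow> 0 \<le> t \<Longrightarrow> \<Psi> t \<le> \<Psi> s + (t - s) * N s"
    and steep: "\<exists>s>0. a * N s + (a - b) / b * s < a * N 0"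
begin

lemma a_pos: "0 < a" using b_pos b_less_a by simp

text \<open>
  A stationary density \<open>N s\<close> balances \<open>s\<close> against the derivative of the mean-field energy. On the
  right branch this derivative is \<open>a \<delta> - \<mu>\<close>, which gives \<open>\<mu> = R s\<close>; on the left branch it is
  \<open>b / (a - b) (\<mu> - a \<delta>)\<close>, which gives \<open>\<mu> = L s\<close>. The function \<open>J \<mu>\<close> is the Legendre dual of the
  energy on the left branch: the concave parabola is the least of its tangents, and \<open>s\<close> is the slope of
  the tangent. Its critical points are the solutions of \<open>L s = \<mu>\<close>.
\<close>

definition R where "R s = a * N s - s"
definition L where "L s = a * N s + (a - b) / b * s"
abbreviation G where "G \<equiv> mean_field a b"
definition J where "J \<mu> s = \<Psi> s + s\<^sup>2 / (2 * b) - (s + \<mu>)\<^sup>2 / (2 * a)"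

lemma G_right: "\<mu> \<le> a * \<delta> \<Longrightarrow> G \<mu> \<delta> = a / 2 * (\<delta> - \<mu> / a)\<^sup>2 - \<mu>\<^sup>2 / (2 * a)"
  using a_pos by (simp add: mean_field_def max_def power2_eq_square field_simps)

lemma G_left: "a * \<delta> \<le> \<mu> \<Longrightarrow> G \<mu> \<delta> = - (a * b / (a - b)) / 2 * (\<delta> - \<mu> / a)\<^sup>2 - \<mu>\<^sup>2 / (2 * a)"
  using a_pos b_less_a by (simp add: mean_field_def max_def power2_eq_square divide_simps) (simp add: algebra_simps)

lemma \<Psi>_deriv: "0 \<le> s \<Longrightarrow> (\<Psi> has_field_derivative N s) (at s within {0..})"
  by (rule supergradient_imp_derivative) (auto intro: \<Psi>_supergradient N_cont)

lemma J_deriv: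
  assumes "0 \<le> s" shows "(J \<mu> has_field_derivative (L s - \<mu>) / a) (at s within {0..})"
proof -
  have "(J \<mu> has_field_derivative N s + s / b - (s + \<mu>) / a) (at s within {0..})"
    unfolding J_def using \<Psi>_deriv[OF assms] a_pos b_pos
    by (auto intro!: derivative_eq_intros simp: field_simps)
  moreover have "N s + s / b - (s + \<mu>) / a = (L s - \<mu>) / a"
    using a_pos b_pos by (simp add: L_def field_simps)
  ultimately show ?thesis by simp
qed

lemma J_cont: "0 \<le> s \<Longrightarrow> continuous_on {s..t} (J \<mu>)"
  by (rule continuous_on_subset[of "{0..}"])
    (auto simp: continuous_on_eq_continuous_within intro: DERIV_continuous J_deriv)

lemma J_deriv_interior: "0 < s \<Longrightarrow> (J \<mu> has_field_derivative (L s - \<mu>) / a) (at s)"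
  using J_deriv[of s \<mu>] at_within_interior[of s "{0..}"] by (simp add: interior_real_atLeast)

lemma J_decreasing:
  assumes "0 \<le> s" "s < t" "\<And>u. s < u \<Longrightarrow> u < t \<Longrightarrow> L u < \<mu>"
  shows "J \<mu> t < J \<mu> s"
proof (rule DERIV_neg_imp_decreasing_open[OF assms(2)])
  show "\<exists>y. DERIV (J \<mu>) x :> y \<and> y < 0" if "s < x" "x < t" for x
    using J_deriv_interior[of x \<mu>] assms that a_pos by (force simp: divide_neg_pos)
qed (use assms J_cont in auto)

lemma J_increasing:
  assumes "0 \<le> s" "s < t" "\<And>u. s < u \<Longrightarrow> u < t \<Longrightarrow> \<mu> < L u"
  shows "J \<mu> s < J \<mu> t"
proof (rule DERIV_pos_imp_increasing_open[OF assms(2)])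
  show "\<exists>y. DERIV (J \<mu>) x :> y \<and> y > 0" if "s < x" "x < t" for x
    using J_deriv_interior[of x \<mu>] assms that a_pos by force
qed (use assms J_cont in auto)

lemma L_cont: "continuous_on {0..} L"
  unfolding L_def by (intro continuous_intros N_cont)

lemma R_cont: "continuous_on {0..} R"
  unfolding R_def by (intro continuous_intros N_cont)

lemma R_less:
  assumes "0 \<le> s" "s < t" shows "R t < R s"
proof -
  have "a * N t < a * N s" using N_less[OF assms] a_pos by simp
  then show ?thesis using assms(2) by (simp add: R_def)
qed

lemma L_between:
  assumes "0 \<le> s" "s < u" "u < t" "L s \<le> \<mu>" "L t \<le> \<mu>"
  shows "L u < \<mu>"
proof -
  define l where "l = (u - s) / (t - s)"
  have l: "0 < l" "l < 1" using assms by (auto simp: l_def field_simps)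
  have u: "u = (1 - l) * s + l * t"
  proof -
    have "l * (t - s) = u - s" using assms by (simp add: l_def)
    then show ?thesis by (simp add: algebra_simps)
  qed
  have "a * N u < a * ((1 - l) * N s + l * N t)"
    unfolding u using N_strictly_convex[of s t l] assms l a_pos by simp
  then have "L u < (1 - l) * L s + l * L t"
    unfolding L_def by (simp add: u algebra_simps add_divide_distrib diff_divide_distrib)
  also have "\<dots> \<le> (1 - l) * \<mu> + l * \<mu>"
    using assms l by (intro add_mono mult_left_mono) auto
  finally show ?thesis by (simp add: algebra_simps)
qed

lemma L_ge: "0 \<le> s \<Longrightarrow> (a - b) / b * s \<le> L s"
  using N_nonneg[of s] a_pos by (simp add: L_def)

text \<open>
  By \<open>L_ge\<close>, beyond \<open>S\<close> the linear term alone exceeds \<open>L 0\<close>, so the minimum over a compact interval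
  is global.
\<close>

lemma L_argmin_exists: "\<exists>s\<ge>0. \<forall>t\<ge>0. L s \<le> L t"
proof -
  define S where "S = b / (a - b) * L 0"
  have S: "0 \<le> S" unfolding S_def using L_ge[of 0] b_pos b_less_a by simp
  have "\<exists>x\<in>{0..S}. \<forall>y\<in>{0..S}. L x \<le> L y"
    by (rule continuous_attains_inf) (use S in \<open>auto intro: continuous_on_subset[OF L_cont]\<close>)
  then obtain s where s: "s \<in> {0..S}" "\<And>y. y \<in> {0..S} \<Longrightarrow> L s \<le> L y" by blast
  have "L s \<le> L t" if "0 \<le> t" for t
  proof (cases "t \<le> S")
    case True then show ?thesis using s that by simp
  next
    case False
    have "L s \<le> L 0" using s(2)[of 0] S by simp
    also have "L 0 = (a - b) / b * S" using b_pos b_less_a by (simp add: S_def)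
    also have "\<dots> \<le> (a - b) / b * t" using False b_pos b_less_a by (intro mult_left_mono) auto
    also have "\<dots> \<le> L t" using L_ge that .
    finally show ?thesis .
  qed
  then show ?thesis using s by auto
qed

definition s_tang where "s_tang = (SOME s. 0 \<le> s \<and> (\<forall>t\<ge>0. L s \<le> L t))"

lemma s_tang_nonneg: "0 \<le> s_tang" and L_s_tang_le: "0 \<le> t \<Longrightarrow> L s_tang \<le> L t"
  using someI_ex[OF L_argmin_exists] by (auto simp: s_tang_def)

lemma L_s_tang_less: "L s_tang < L 0"
proof -
  obtain s where s: "0 < s" "L s < L 0" using steep by (auto simp: L_def)
  then show ?thesis using L_s_tang_le[of s] by linarith
qed

lemma L_less:
  assumes "s_tang \<le> s" "s < t" shows "L s < L t"
proof (cases "s = s_tang")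
  case True
  show ?thesis
  proof (rule ccontr)
    assume "\<not> L s < L t"
    then have "L ((s + t) / 2) < L s"
      using L_between[of s "(s + t) / 2" t "L s"] s_tang_nonneg assms by auto
    then show False using L_s_tang_le[of "(s + t) / 2"] True s_tang_nonneg assms by auto
  qed
next
  case False
  then show ?thesis
    using L_between[of s_tang s t "L t"] L_s_tang_le[of t] s_tang_nonneg assms by auto
qed

text \<open>
  The candidates. On the left branch only solutions beyond \<open>s_tang\<close> are local minima; the other
  solution of \<open>L s = \<mu>\<close> is the barrier between the wells.
\<close>

definition s_R where "s_R \<mu> = (THE s. 0 \<le> s \<and> R s = \<mu>)"
definition s_L where "s_L \<mu> = (THE s. s_tang \<le> s \<and> L s = \<mu>)"

lemma s_R: assumes "\<mu> \<le> R 0" shows s_R_nonneg: "0 \<le> s_R \<mu>" and R_s_R: "R (s_R \<mu>) = \<mu>"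
proof -
  define S where "S = a * N 0 - \<mu>"
  have S: "0 \<le> S" using assms by (simp add: S_def R_def)
  have "N S \<le> N 0" using N_less[of 0 S] S by (cases "S = 0") auto
  then have "R S \<le> \<mu>" using a_pos by (simp add: R_def S_def)
  then have "\<exists>x. 0 \<le> x \<and> x \<le> S \<and> R x = \<mu>"
    by (intro IVT2') (use assms S continuous_on_subset[OF R_cont] in auto)
  then obtain s where s: "0 \<le> s \<and> R s = \<mu>" by auto
  have "\<exists>!s. 0 \<le> s \<and> R s = \<mu>"
  proof (rule ex1I)
    show "0 \<le> s \<and> R s = \<mu>" by (rule s)
    fix y assume "0 \<le> y \<and> R y = \<mu>"
    then show "y = s" using s R_less[of y s] R_less[of s y] by (cases y s rule: linorder_cases) auto
  qed
  from theI'[OF this] show "0 \<le> s_R \<mu>" "R (s_R \<mu>) = \<mu>" by (auto simp: s_R_def)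
qed

lemma s_L: assumes "L s_tang \<le> \<mu>" shows s_L_ge: "s_tang \<le> s_L \<mu>" and L_s_L: "L (s_L \<mu>) = \<mu>"
proof -
  define S where "S = max s_tang (b / (a - b) * \<mu>)"
  have S: "s_tang \<le> S" by (simp add: S_def)
  have "\<mu> = (a - b) / b * (b / (a - b) * \<mu>)" using b_pos b_less_a by simp
  also have "\<dots> \<le> (a - b) / b * S" using b_pos b_less_a by (intro mult_left_mono) (auto simp: S_def)
  also have "\<dots> \<le> L S" using L_ge S s_tang_nonneg by simp
  finally have "\<exists>x. s_tang \<le> x \<and> x \<le> S \<and> L x = \<mu>"
    by (intro IVT') (use assms S s_tang_nonneg continuous_on_subset[OF L_cont] in auto)
  then obtain s where s: "s_tang \<le> s \<and> L s = \<mu>" by auto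
  have "\<exists>!s. s_tang \<le> s \<and> L s = \<mu>"
  proof (rule ex1I)
    show "s_tang \<le> s \<and> L s = \<mu>" by (rule s)
    fix y assume "s_tang \<le> y \<and> L y = \<mu>"
    then show "y = s" using s L_less[of y s] L_less[of s y] by (cases y s rule: linorder_cases) auto
  qed
  from theI'[OF this] show "s_tang \<le> s_L \<mu>" "L (s_L \<mu>) = \<mu>" by (auto simp: s_L_def)
qed

lemma s_R_cont: "continuous_on {..R 0} s_R"
proof -
  have "continuous_on {- R 0..} (\<lambda>y. s_R (- y))"
    by (rule continuous_on_inverse_half_line[where f = "\<lambda>s. - R s" and l = 0])
      (use s_R R_less R_cont in \<open>auto intro!: continuous_intros\<close>)
  from continuous_on_compose2[OF this, of "{..R 0}" uminus] show ?thesis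
    by (simp add: continuous_on_minus continuous_on_id image_subset_iff)
qed

lemma s_L_cont: "continuous_on {L s_tang..} s_L"
  by (rule continuous_on_inverse_half_line)
    (use s_L L_less L_cont s_tang_nonneg in \<open>auto intro: continuous_on_subset\<close>)

definition P_R where "P_R \<mu> = \<Psi> (s_R \<mu>) - (s_R \<mu> + \<mu>)\<^sup>2 / (2 * a)"
definition P_L where "P_L \<mu> = J \<mu> (s_L \<mu>)"

lemma R_0: "R 0 = a * N 0" and L_0: "L 0 = a * N 0"
  by (simp_all add: R_def L_def)

lemma N_s_R: "\<mu> \<le> a * N 0 \<Longrightarrow> N (s_R \<mu>) = (s_R \<mu> + \<mu>) / a"
  using R_s_R[of \<mu>] a_pos by (simp add: R_0) (simp add: R_def field_simps)

lemma N_s_L: "L s_tang \<le> \<mu> \<Longrightarrow> N (s_L \<mu>) = \<mu> / a - (a - b) / (a * b) * s_L \<mu>"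
  using L_s_L[of \<mu>] a_pos b_pos by (simp add: L_def field_simps)

lemma s_L_gt_0: assumes "L s_tang \<le> \<mu>" shows "0 < s_L \<mu>"
proof -
  have "s_tang \<noteq> 0" using L_s_tang_less by auto
  then show ?thesis using s_L_ge[OF assms] s_tang_nonneg by linarith
qed

lemma s_R_gt_0: assumes "\<mu> < a * N 0" shows "0 < s_R \<mu>"
proof -
  have "s_R \<mu> \<noteq> 0" using assms R_s_R[of \<mu>] by (auto simp: R_0)
  then show ?thesis using s_R_nonneg[of \<mu>] assms by (simp add: R_0)
qed

lemma s_R_0: "s_R (a * N 0) = 0"
proof (rule ccontr)
  assume "s_R (a * N 0) \<noteq> 0"
  then have "0 < s_R (a * N 0)" using s_R_nonneg[of "a * N 0"] by (simp add: R_0)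
  then have "R (s_R (a * N 0)) < R 0" by (intro R_less) auto
  then show False using R_s_R[of "a * N 0"] by (simp add: R_0)
qed

text \<open>
  The left candidate has density below \<open>\<mu> / a\<close> and the right one at least \<open>\<mu> / a\<close>, and \<open>N\<close> is
  decreasing. This inequality is what makes the two values cross transversally.
\<close>

lemma s_R_less_s_L:
  assumes "L s_tang \<le> \<mu>" "\<mu> \<le> a * N 0" shows "s_R \<mu> < s_L \<mu>"
proof (rule ccontr)
  assume "\<not> s_R \<mu> < s_L \<mu>"
  then have "N (s_R \<mu>) \<le> N (s_L \<mu>)"
    using N_less[of "s_L \<mu>" "s_R \<mu>"] s_L_gt_0[OF assms(1)] by (cases "s_L \<mu> = s_R \<mu>") auto
  moreover have "N (s_L \<mu>) < \<mu> / a"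
    using N_s_L[OF assms(1)] s_L_gt_0[OF assms(1)] a_pos b_pos b_less_a by simp
  moreover have "\<mu> / a \<le> N (s_R \<mu>)"
    using N_s_R[OF assms(2)] s_R_nonneg[of \<mu>] assms(2) a_pos by (simp add: R_0 divide_right_mono)
  ultimately show False by linarith
qed

lemma L_below:
  assumes "0 \<le> s" "s < u" "u < s_L \<mu>" "L s \<le> \<mu>" "L s_tang \<le> \<mu>"
  shows "L u < \<mu>"
  using L_between[OF assms(1-4)] L_s_L[OF assms(5)] by simp

text \<open>
  \<open>J \<mu>\<close> decreases where \<open>L < \<mu>\<close> and increases where \<open>L > \<mu>\<close>. From a starting point left of \<open>s_L \<mu>\<close>
  with \<open>L s \<le> \<mu>\<close>, strict convexity keeps \<open>L\<close> below \<open>\<mu>\<close> all the way to \<open>s_L \<mu>\<close>.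
\<close>

lemma P_L_less_J:
  assumes "L s_tang \<le> \<mu>" "0 \<le> s" "s \<noteq> s_L \<mu>" "s_tang \<le> s \<or> L s \<le> \<mu>"
  shows "P_L \<mu> < J \<mu> s"
proof (cases "s < s_L \<mu>")
  case True
  have "L s \<le> \<mu>"
    using assms(4) True L_less[of s "s_L \<mu>"] L_s_L[OF assms(1)] by auto
  then show ?thesis
    unfolding P_L_def using True assms L_below[of s] by (intro J_decreasing) auto
next
  case False
  show ?thesis
    unfolding P_L_def
  proof (rule J_increasing)
    show "\<mu> < L u" if "s_L \<mu> < u" for u
      using L_less[of "s_L \<mu>" u] L_s_L[OF assms(1)] s_L_ge[OF assms(1)] that by auto
  qed (use False assms s_L_gt_0[OF assms(1)] in auto)
qed

text \<open>
  On the right branch the duality is a maximum instead of a minimum: \<open>\<Psi> s - (s + \<mu>)\<^sup>2 / (2 a)\<close> is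
  concave in \<open>s\<close> and stationary where \<open>R s = \<mu>\<close>.
\<close>

lemma tilted_le_P_R:
  assumes "\<mu> \<le> a * N 0" "0 \<le> s"
  shows "\<Psi> s - (s + \<mu>)\<^sup>2 / (2 * a) \<le> P_R \<mu>"
proof -
  have "\<Psi> s \<le> \<Psi> (s_R \<mu>) + (s - s_R \<mu>) * ((s_R \<mu> + \<mu>) / a)"
    using \<Psi>_supergradient[of "s_R \<mu>" s] s_R_nonneg[of \<mu>] assms N_s_R[OF assms(1)] by (simp add: R_0)
  moreover have "(s - r) * ((r + \<mu>) / a) - (s + \<mu>)\<^sup>2 / (2 * a) + (r + \<mu>)\<^sup>2 / (2 * a) = - (s - r)\<^sup>2 / (2 * a)" for r
    using a_pos by (simp add: field_simps power2_eq_square)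
  moreover have "- (s - s_R \<mu>)\<^sup>2 / (2 * a) \<le> 0" using a_pos by simp
  ultimately show ?thesis unfolding P_R_def by smt
qed

text \<open>
  After adding \<open>\<mu>\<^sup>2 / (2 a)\<close>, the quantities optimised over \<open>s\<close> are affine in \<open>\<mu>\<close> with slope
  \<open>- s / a\<close>. So \<open>P_R\<close> becomes a maximum of affine functions, and \<open>P_L\<close> below a minimum of them; testing
  one parameter with the optimal \<open>s\<close> of the other gives the affine bounds.
\<close>

lemma P_R_supergradient:
  assumes "\<mu> \<le> a * N 0" "\<nu> \<le> a * N 0"
  shows "- (P_R \<nu> + \<nu>\<^sup>2 / (2 * a)) \<le> - (P_R \<mu> + \<mu>\<^sup>2 / (2 * a)) + (\<nu> - \<mu>) * (s_R \<mu> / a)"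
proof -
  have "\<Psi> r - (r + \<nu>)\<^sup>2 / (2 * a) + \<nu>\<^sup>2 / (2 * a) =
      \<Psi> r - (r + \<mu>)\<^sup>2 / (2 * a) + \<mu>\<^sup>2 / (2 * a) - (\<nu> - \<mu>) * (r / a)" for r
    using a_pos by (simp add: field_simps power2_eq_square)
  from this[of "s_R \<mu>"] tilted_le_P_R[OF assms(2), of "s_R \<mu>"] s_R_nonneg[of \<mu>] assms(1)
  show ?thesis by (simp add: P_R_def R_0)
qed

lemma P_L_supergradient:
  assumes "L s_tang \<le> \<mu>" "L s_tang \<le> \<nu>"
  shows "P_L \<nu> + \<nu>\<^sup>2 / (2 * a) \<le> P_L \<mu> + \<mu>\<^sup>2 / (2 * a) + (\<nu> - \<mu>) * (- s_L \<mu> / a)"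
proof -
  have shift: "J \<nu> r + \<nu>\<^sup>2 / (2 * a) = J \<mu> r + \<mu>\<^sup>2 / (2 * a) + (\<nu> - \<mu>) * (- r / a)" for r
    using a_pos by (simp add: J_def field_simps power2_eq_square)
  have "P_L \<nu> \<le> J \<nu> (s_L \<mu>)"
    using P_L_less_J[OF assms(2), of "s_L \<mu>"] s_L_ge[OF assms(1)] s_tang_nonneg P_L_def
    by (cases "s_L \<mu> = s_L \<nu>") auto
  then show ?thesis using shift[of "s_L \<mu>"] unfolding P_L_def[of \<mu>] by linarith
qed

lemma square_deriv: "((\<lambda>\<nu>. \<nu>\<^sup>2 / (2 * a)) has_field_derivative \<mu> / a) (at \<mu> within S)"
  using a_pos by (auto intro!: derivative_eq_intros simp: field_simps)

lemma P_R_deriv: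
  assumes "\<mu> \<le> a * N 0"
  shows "(P_R has_field_derivative - (s_R \<mu> + \<mu>) / a) (at \<mu> within {..a * N 0})"
proof -
  have "((\<lambda>\<nu>. - (P_R \<nu> + \<nu>\<^sup>2 / (2 * a))) has_field_derivative s_R \<mu> / a) (at \<mu> within {..a * N 0})"
    by (rule supergradient_imp_derivative)
      (use assms P_R_supergradient s_R_cont a_pos in \<open>auto simp: R_0 intro!: continuous_intros\<close>)
  from DERIV_diff[OF DERIV_minus[OF this] square_deriv] show ?thesis
    by (simp add: add_divide_distrib diff_divide_distrib)
qed

lemma P_L_deriv:
  assumes "L s_tang \<le> \<mu>"
  shows "(P_L has_field_derivative - (s_L \<mu> + \<mu>) / a) (at \<mu> within {L s_tang..})"
proof -
  have "((\<lambda>\<nu>. P_L \<nu> + \<nu>\<^sup>2 / (2 * a)) has_field_derivative - s_L \<mu> / a) (at \<mu> within {L s_tang..})"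
    by (rule supergradient_imp_derivative)
      (use assms P_L_supergradient s_L_cont a_pos in \<open>auto intro!: continuous_intros\<close>)
  from DERIV_diff[OF this square_deriv] show ?thesis
    by (simp add: add_divide_distrib diff_divide_distrib)
qed

text \<open>
  Here \<open>e\<close> and \<open>\<delta>\<close> are the values of the two parts of the functional at some sequence. The convex
  parabola lies above its tangent of slope \<open>s_R \<mu>\<close>, and \<open>e + s_R \<mu> * \<delta>\<close> is at least \<open>\<Psi>\<close>; both are
  equalities only at the candidate.
\<close>

lemma right_well_bound:
  assumes "\<mu> \<le> a * N 0" "\<mu> \<le> a * \<delta>" "\<Psi> (s_R \<mu>) \<le> e + s_R \<mu> * \<delta>"
  shows "P_R \<mu> < e + G \<mu> \<delta> \<or> e + G \<mu> \<delta> = P_R \<mu> \<and> \<Psi> (s_R \<mu>) = e + s_R \<mu> * \<delta>"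
proof -
  have "G \<mu> \<delta> = s * \<delta> - (s + \<mu>)\<^sup>2 / (2 * a) + a / 2 * (\<delta> - (\<mu> + s) / a)\<^sup>2" for s
    unfolding G_right[OF assms(2)] using a_pos by (simp add: field_simps power2_eq_square)
  from this[of "s_R \<mu>"] have "P_R \<mu> + a / 2 * (\<delta> - (\<mu> + s_R \<mu>) / a)\<^sup>2 + (e + s_R \<mu> * \<delta> - \<Psi> (s_R \<mu>)) = e + G \<mu> \<delta>"
    by (simp add: P_R_def)
  moreover have "0 \<le> a / 2 * (\<delta> - (\<mu> + s_R \<mu>) / a)\<^sup>2" using a_pos by simp
  ultimately show ?thesis using assms(3) by linarith
qed

text \<open>
  \<open>\<Psi> s - s \<mu> / a\<close> increases as long as \<open>N s \<ge> \<mu> / a\<close> and is maximal where equality holds.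
\<close>

lemma tilted_max:
  assumes "0 \<le> s" "0 \<le> r" "\<mu> \<le> a * N s \<and> s \<ge> r \<or> \<mu> = a * N s"
  shows "\<Psi> r - r * \<mu> / a \<le> \<Psi> s - s * \<mu> / a"
proof -
  have "\<Psi> r \<le> \<Psi> s + (r - s) * N s" using \<Psi>_supergradient assms by simp
  also have "(r - s) * N s \<le> (r - s) * (\<mu> / a)"
    using assms(3)
  proof
    assume *: "\<mu> \<le> a * N s \<and> s \<ge> r"
    then have "\<mu> / a \<le> N s" using a_pos by (simp add: field_simps)
    then show ?thesis using * by (intro mult_left_mono_neg) auto
  qed (use a_pos in simp)
  finally show ?thesis by (simp add: algebra_simps diff_divide_distrib)
qed

text \<open>
  Left of \<open>\<mu> / a\<close> but not beyond the barrier, the energy exceeds that of the right well. A direct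
  comparison with the value at density \<open>\<mu> / a\<close> would need the derivative of the inverse of \<open>N\<close>; the
  dual inequality \<open>adm\<close> avoids this, since it can be applied at a slope \<open>\<sigma>\<close> chosen for each case. Here
  \<open>s\<close> is the derivative of the mean-field energy at \<open>\<delta>\<close>, and \<open>r = s_R \<mu>\<close>. The slope \<open>\<sigma> = s\<close>
  gives \<open>J \<mu> s\<close> as lower bound. It is large enough if \<open>r \<le> s\<close> and \<open>N s \<ge> \<mu> / a\<close>; for \<open>s < r\<close> the slope
  \<open>\<sigma> = r\<close> does it; and if \<open>N s < \<mu> / a\<close>, then \<open>J \<mu> s\<close> is compared with its value at the point \<open>x < s\<close>
  where \<open>N x = \<mu> / a\<close>, because \<open>J \<mu>\<close> increases on the whole interval.
\<close>

lemma barrier_bound: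
  assumes s: "0 < s" and above: "\<And>u. 0 \<le> u \<Longrightarrow> u < s \<Longrightarrow> \<mu> < L u" and mu: "\<mu> \<le> a * N 0"
    and \<delta>: "a * \<delta> = \<mu> - (a - b) / b * s"
    and adm: "\<And>\<sigma>. 0 \<le> \<sigma> \<Longrightarrow> \<Psi> \<sigma> \<le> e + \<sigma> * \<delta>"
  shows "P_R \<mu> < e + G \<mu> \<delta>"
proof -
  define c where "c = a * b / (a - b)"
  define r where "r = s_R \<mu>"
  have c: "c > 0" using a_pos b_pos b_less_a by (simp add: c_def)
  have r: "0 \<le> r" using s_R_nonneg[of \<mu>] mu by (simp add: r_def R_0)
  have \<delta>': "\<delta> = \<mu> / a - s / c" using \<delta> a_pos b_pos b_less_a by (simp add: c_def field_simps)
  have "0 < (a - b) / b * s" using s b_pos b_less_a by simp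
  then have "a * \<delta> \<le> \<mu>" using \<delta> by simp
  then have G: "G \<mu> \<delta> = - s\<^sup>2 / (2 * c) - \<mu>\<^sup>2 / (2 * a)"
    using c by (simp add: G_left \<delta>' c_def[symmetric] field_simps power2_eq_square)
  have J_eq: "J \<mu> \<sigma> = \<Psi> \<sigma> - \<sigma> * \<mu> / a + \<sigma>\<^sup>2 / (2 * c) - \<mu>\<^sup>2 / (2 * a)" for \<sigma>
    using a_pos b_pos b_less_a by (simp add: J_def c_def field_simps power2_eq_square)
  have P: "P_R \<mu> = \<Psi> r - r * \<mu> / a - r\<^sup>2 / (2 * a) - \<mu>\<^sup>2 / (2 * a)"
    using a_pos by (simp add: P_R_def r_def field_simps power2_eq_square)
  have sq: "0 \<le> r\<^sup>2 / (2 * a)" using a_pos by simp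
  have at_s: "J \<mu> s \<le> e + G \<mu> \<delta>"
  proof -
    have "s * \<delta> = s * \<mu> / a - s\<^sup>2 / c" by (simp add: \<delta>' algebra_simps power2_eq_square)
    moreover have "s\<^sup>2 / c = s\<^sup>2 / (2 * c) + s\<^sup>2 / (2 * c)" by (simp add: field_simps)
    moreover have "\<Psi> s \<le> e + s * \<delta>" using adm s by simp
    ultimately show ?thesis unfolding G J_eq by linarith
  qed
  consider (shallow) "\<mu> \<le> a * N s" "r \<le> s" | (below) "s < r" | (deep) "a * N s < \<mu>" by linarith
  then show ?thesis
  proof cases
    case shallow
    have "0 < s\<^sup>2 / (2 * c)" using s c by simp
    moreover have "\<Psi> r - r * \<mu> / a \<le> \<Psi> s - s * \<mu> / a"
      using tilted_max[of s r \<mu>] shallow s r by simp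
    ultimately show ?thesis using at_s sq unfolding J_eq P by linarith
  next
    case below
    have "\<Psi> r \<le> e + r * \<mu> / a - r * s / c" using adm[OF r] by (simp add: \<delta>' algebra_simps)
    moreover have "r * s / c > s\<^sup>2 / (2 * c)"
    proof -
      have "s * s < 2 * (r * s)" using mult_strict_right_mono[OF below s] r s by (smt mult_nonneg_nonneg)
      then show ?thesis using c by (simp add: field_simps power2_eq_square)
    qed
    ultimately show ?thesis using sq unfolding G P by linarith
  next
    case deep
    have "\<exists>x. 0 \<le> x \<and> x \<le> s \<and> N x = \<mu> / a"
      by (intro IVT2') (use deep mu s a_pos continuous_on_subset[OF N_cont] in \<open>auto simp: field_simps\<close>)
    then obtain x where x: "0 \<le> x" "x \<le> s" "N x = \<mu> / a" by auto
    have "L 0 > \<mu>" using above[of 0] s by simp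
    then have "x \<noteq> 0" using x a_pos by (auto simp: L_0)
    have "x \<noteq> s" using deep x a_pos by auto
    then have "J \<mu> x < J \<mu> s" using x above by (intro J_increasing) auto
    moreover have "\<Psi> r - r * \<mu> / a \<le> \<Psi> x - x * \<mu> / a"
      using tilted_max[of x r \<mu>] x r a_pos by simp
    moreover have "0 \<le> x\<^sup>2 / (2 * c)" using c by simp
    ultimately show ?thesis using at_s sq unfolding J_eq P by linarith
  qed
qed

lemma G_left_tangent:
  assumes "0 \<le> s" "a * \<delta> = \<mu> - (a - b) / b * s"
  shows "e + G \<mu> \<delta> = J \<mu> s + (e + s * \<delta> - \<Psi> s)"
proof -
  define k where "k = (a - b) / (a * b)"
  have k: "k > 0" "a * b / (a - b) = 1 / k" "k = 1 / b - 1 / a"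
    using a_pos b_pos b_less_a by (simp_all add: k_def field_simps)
  have "0 \<le> (a - b) / b * s" using assms(1) b_pos b_less_a by simp
  then have le: "a * \<delta> \<le> \<mu>" using assms(2) by simp
  have \<delta>: "\<delta> = \<mu> / a - k * s"
    using assms(2) a_pos b_pos by (simp add: k_def field_simps)
  have "G \<mu> \<delta> = - k * s\<^sup>2 / 2 - \<mu>\<^sup>2 / (2 * a)"
    unfolding G_left[OF le] k(2) using k(1) by (simp add: \<delta> power_mult_distrib) (simp add: power2_eq_square)
  moreover have "s\<^sup>2 / (2 * b) - (s + \<mu>)\<^sup>2 / (2 * a) = k * s\<^sup>2 / 2 - s * \<mu> / a - \<mu>\<^sup>2 / (2 * a)"
    unfolding k(3) using a_pos b_pos by (simp add: field_simps power2_eq_square)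
  moreover have "s * \<delta> = s * \<mu> / a - k * s\<^sup>2 / 2 - k * s\<^sup>2 / 2"
    by (simp add: \<delta> algebra_simps power2_eq_square)
  ultimately show ?thesis unfolding J_def by linarith
qed

text \<open>
  The hypothesis holds for the two parts \<open>e\<close> and \<open>\<delta>\<close> of the energy of every sequence in the box. Right
  of \<open>\<mu> / a\<close> the bound is \<open>right_well_bound\<close>, or, once \<open>\<mu>\<close> exceeds \<open>a N 0\<close> and no right candidate is
  left, a comparison with \<open>J \<mu> 0\<close>. Left of \<open>\<mu> / a\<close> it depends on whether \<open>L\<close> has come down to \<open>\<mu>\<close>
  before \<open>s\<close>: if not, the point lies before the barrier; if so, \<open>J \<mu> s\<close> is at least \<open>P_L \<mu>\<close>. The
  equation in the equality cases identifies the sequence, since \<open>\<Psi>\<close> is attained once.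
\<close>

theorem two_well_bound:
  assumes adm: "\<And>\<sigma>. 0 \<le> \<sigma> \<Longrightarrow> \<Psi> \<sigma> \<le> e + \<sigma> * \<delta>"
  shows "\<mu> \<le> a * N 0 \<and> (P_R \<mu> < e + G \<mu> \<delta> \<or> e + G \<mu> \<delta> = P_R \<mu> \<and> \<Psi> (s_R \<mu>) = e + s_R \<mu> * \<delta>)
       \<or> L s_tang \<le> \<mu> \<and> (P_L \<mu> < e + G \<mu> \<delta> \<or> e + G \<mu> \<delta> = P_L \<mu> \<and> \<Psi> (s_L \<mu>) = e + s_L \<mu> * \<delta>)"
proof (cases "\<mu> \<le> a * \<delta>")
  case right: True
  show ?thesis
  proof (cases "\<mu> \<le> a * N 0")
    case True
    then show ?thesis using right_well_bound[OF True right adm] s_R_nonneg[of \<mu>] by (simp add: R_0)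
  next
    case False
    \<comment> \<open>For such \<open>\<mu>\<close> the whole initial part of \<open>L\<close> lies below \<open>\<mu>\<close>, so \<open>J \<mu>\<close> decreases from \<open>0\<close> on.\<close>
    then have mu: "L s_tang \<le> \<mu>" "L 0 \<le> \<mu>" using L_s_tang_less by (auto simp: L_0)
    have "P_L \<mu> < J \<mu> 0" by (rule P_L_less_J) (use mu s_L_gt_0[OF mu(1)] in auto)
    also have "J \<mu> 0 \<le> e + G \<mu> \<delta>"
    proof -
      have "0 \<le> a * (\<delta> - \<mu> / a)\<^sup>2 / 2" using a_pos by simp
      then show ?thesis using adm[of 0] G_right[OF right] by (simp add: J_def)
    qed
    finally show ?thesis using mu by simp
  qed
next
  case left: False
  define s where "s = b / (a - b) * (\<mu> - a * \<delta>)"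
  have s: "0 < s" using left b_pos b_less_a by (simp add: s_def)
  have \<delta>: "a * \<delta> = \<mu> - (a - b) / b * s" using b_pos b_less_a by (simp add: s_def)
  have eJ: "e + G \<mu> \<delta> = J \<mu> s + (e + s * \<delta> - \<Psi> s)"
    using G_left_tangent[OF _ \<delta>] s by simp
  show ?thesis
  proof (cases "\<forall>u. 0 \<le> u \<and> u < s \<longrightarrow> \<mu> < L u")
    case True
    then have "\<mu> \<le> a * N 0" using s by (auto simp: L_0[symmetric] less_imp_le)
    then show ?thesis using barrier_bound[OF s _ _ \<delta> adm] True by auto
  next
    case False
    then obtain u where u: "0 \<le> u" "u < s" "L u \<le> \<mu>" by (auto simp: not_less)
    then have mu: "L s_tang \<le> \<mu>" using L_s_tang_le[of u] by simp
    have "s_tang \<le> s \<or> L s \<le> \<mu>"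
      using L_between[of u s s_tang \<mu>] u mu by fastforce
    then have "P_L \<mu> < J \<mu> s \<or> s = s_L \<mu>" using P_L_less_J[OF mu, of s] s by auto
    then show ?thesis using eJ adm[of s] s mu unfolding P_L_def by auto
  qed
qed

lemma P_R_attained:
  assumes "\<mu> \<le> a * N 0"
  shows "\<Psi> (s_R \<mu>) - s_R \<mu> * N (s_R \<mu>) + G \<mu> (N (s_R \<mu>)) = P_R \<mu>"
proof -
  have *: "\<mu> \<le> a * N (s_R \<mu>)"
    using N_s_R[OF assms] s_R_nonneg[of \<mu>] assms a_pos by (simp add: R_0)
  have "- r * ((r + \<mu>) / a) + (a / 2 * ((r + \<mu>) / a - \<mu> / a)\<^sup>2 - \<mu>\<^sup>2 / (2 * a)) = - (r + \<mu>)\<^sup>2 / (2 * a)" for r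
    using a_pos by (simp add: field_simps power2_eq_square)
  from this[of "s_R \<mu>"] show ?thesis
    using G_right[OF *] by (simp add: N_s_R[OF assms] P_R_def)
qed

lemma N_s_L_eq: "L s_tang \<le> \<mu> \<Longrightarrow> a * N (s_L \<mu>) = \<mu> - (a - b) / b * s_L \<mu>"
  using N_s_L[of \<mu>] a_pos b_pos by (simp add: field_simps)

lemma P_L_attained:
  assumes "L s_tang \<le> \<mu>"
  shows "\<Psi> (s_L \<mu>) - s_L \<mu> * N (s_L \<mu>) + G \<mu> (N (s_L \<mu>)) = P_L \<mu>"
  using G_left_tangent[OF _ N_s_L_eq[OF assms], of "\<Psi> (s_L \<mu>) - s_L \<mu> * N (s_L \<mu>)"] s_L_gt_0[OF assms]
  by (simp add: P_L_def)

definition gap where "gap \<mu> = P_R \<mu> - P_L \<mu>"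

lemma gap_cont: "continuous_on {L s_tang..a * N 0} gap"
  unfolding gap_def continuous_on_eq_continuous_within
proof
  fix x assume x: "x \<in> {L s_tang..a * N 0}"
  have "continuous (at x within {L s_tang..a * N 0}) P_R"
    by (rule continuous_within_subset[OF DERIV_continuous[OF P_R_deriv]]) (use x in auto)
  moreover have "continuous (at x within {L s_tang..a * N 0}) P_L"
    by (rule continuous_within_subset[OF DERIV_continuous[OF P_L_deriv]]) (use x in auto)
  ultimately show "continuous (at x within {L s_tang..a * N 0}) (\<lambda>x. P_R x - P_L x)"
    by (rule continuous_diff)
qed

lemma gap_strict_mono:
  assumes "L s_tang \<le> \<mu>" "\<mu> < \<nu>" "\<nu> \<le> a * N 0"
  shows "gap \<mu> < gap \<nu>"
proof (rule DERIV_pos_imp_increasing_open[OF assms(2)])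
  fix x assume x: "\<mu> < x" "x < \<nu>"
  have "DERIV P_R x :> - (s_R x + x) / a"
    using P_R_deriv[of x] x assms at_within_interior[of x "{..a * N 0}"] by (simp add: interior_real_atMost)
  moreover have "DERIV P_L x :> - (s_L x + x) / a"
    using P_L_deriv[of x] x assms at_within_interior[of x "{L s_tang..}"] by (simp add: interior_real_atLeast)
  ultimately have "DERIV gap x :> - (s_R x + x) / a - - (s_L x + x) / a"
    unfolding gap_def by (rule DERIV_diff)
  moreover have "0 < - (s_R x + x) / a - - (s_L x + x) / a"
    using s_R_less_s_L[of x] x assms a_pos by (simp add: field_simps)
  ultimately show "\<exists>y. DERIV gap x :> y \<and> 0 < y" by blast
next
  show "continuous_on {\<mu>..\<nu>} gap"
    by (rule continuous_on_subset[OF gap_cont]) (use assms in auto)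
qed

text \<open>
  For \<open>\<mu> = L s_tang\<close> the function \<open>J \<mu>\<close> increases all the way up to \<open>s_tang\<close>, so the left candidate
  itself still satisfies the hypotheses of \<open>barrier_bound\<close>.
\<close>

lemma gap_s_tang: "gap (L s_tang) < 0"
proof -
  define \<mu> where "\<mu> = L s_tang"
  define s where "s = s_L \<mu>"
  have s: "s = s_tang"
    using s_L_ge[of \<mu>] L_s_L[of \<mu>] L_less[of s_tang s] by (force simp: s_def \<mu>_def)
  have pos: "0 < s" using s_L_gt_0[of \<mu>] by (simp add: s_def \<mu>_def)
  have "P_R \<mu> < (\<Psi> s - s * N s) + G \<mu> (N s)"
  proof (rule barrier_bound[OF pos])
    show "\<mu> < L u" if u: "0 \<le> u" "u < s" for u
    proof (rule ccontr)
      assume "\<not> \<mu> < L u"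
      then have "L ((u + s) / 2) < \<mu>"
        using L_between[of u "(u + s) / 2" s \<mu>] u by (simp add: \<mu>_def s)
      then show False using L_s_tang_le[of "(u + s) / 2"] u by (simp add: \<mu>_def)
    qed
    show "\<mu> \<le> a * N 0" using L_s_tang_less by (simp add: \<mu>_def L_0)
    show "a * N s = \<mu> - (a - b) / b * s" by (simp add: \<mu>_def s L_def)
    show "\<Psi> \<sigma> \<le> \<Psi> s - s * N s + \<sigma> * N s" if "0 \<le> \<sigma>" for \<sigma>
      using \<Psi>_supergradient[of s \<sigma>] that pos by (simp add: algebra_simps)
  qed
  also have "\<dots> = P_L \<mu>" unfolding s_def by (rule P_L_attained) (simp add: \<mu>_def)
  finally show ?thesis by (simp add: gap_def \<mu>_def)
qed

lemma gap_top: "0 < gap (a * N 0)"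
proof -
  have mu: "L s_tang \<le> a * N 0" "L 0 \<le> a * N 0" using L_s_tang_less by (auto simp: L_0)
  have "P_L (a * N 0) < J (a * N 0) 0"
    by (rule P_L_less_J) (use mu s_L_gt_0[OF mu(1)] in auto)
  also have "\<dots> = P_R (a * N 0)" by (simp add: J_def P_R_def s_R_0)
  finally show ?thesis by (simp add: gap_def)
qed

lemma crossing_exists:
  obtains \<nu> where "L s_tang < \<nu>" "\<nu> < a * N 0" "P_R \<nu> = P_L \<nu>"
    "\<And>\<mu>. L s_tang \<le> \<mu> \<Longrightarrow> \<mu> < \<nu> \<Longrightarrow> P_R \<mu> < P_L \<mu>"
    "\<And>\<mu>. \<nu> < \<mu> \<Longrightarrow> \<mu> \<le> a * N 0 \<Longrightarrow> P_L \<mu> < P_R \<mu>"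
proof -
  have "\<exists>x. L s_tang \<le> x \<and> x \<le> a * N 0 \<and> gap x = 0"
    by (rule IVT') (use gap_s_tang gap_top L_s_tang_less gap_cont in \<open>auto simp: L_0\<close>)
  then obtain \<nu> where \<nu>: "L s_tang \<le> \<nu>" "\<nu> \<le> a * N 0" "gap \<nu> = 0" by blast
  show thesis
  proof (rule that)
    show "L s_tang < \<nu>" using \<nu> gap_s_tang by (cases "L s_tang = \<nu>") auto
    show "\<nu> < a * N 0" using \<nu> gap_top by (cases "a * N 0 = \<nu>") auto
    show "P_R \<nu> = P_L \<nu>" using \<nu>(3) by (simp add: gap_def)
    show "P_R \<mu> < P_L \<mu>" if "L s_tang \<le> \<mu>" "\<mu> < \<nu>" for \<mu>
      using gap_strict_mono[OF that \<nu>(2)] \<nu>(3) by (simp add: gap_def)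
    show "P_L \<mu> < P_R \<mu>" if "\<nu> < \<mu>" "\<mu> \<le> a * N 0" for \<mu>
      using gap_strict_mono[OF \<nu>(1) that] \<nu>(3) by (simp add: gap_def)
  qed
qed

definition P where "P \<nu> \<mu> = (if \<mu> \<le> \<nu> then P_R \<mu> else P_L \<mu>)"

lemma P_differentiable:
  assumes "L s_tang < \<nu>" "\<nu> < a * N 0"
  shows "P \<nu> differentiable_on ({..<\<nu>} \<union> {\<nu><..})"
proof (rule differentiable_at_imp_differentiable_on)
  fix \<mu> assume "\<mu> \<in> {..<\<nu>} \<union> {\<nu><..}"
  then consider "\<mu> < \<nu>" | "\<nu> < \<mu>" by auto
  then have "\<exists>D. (P \<nu> has_field_derivative D) (at \<mu>)"
  proof cases
    case 1
    have "DERIV P_R \<mu> :> - (s_R \<mu> + \<mu>) / a"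
      using P_R_deriv[of \<mu>] 1 assms at_within_interior[of \<mu> "{..a * N 0}"] by (simp add: interior_real_atMost)
    then have "DERIV (P \<nu>) \<mu> :> - (s_R \<mu> + \<mu>) / a"
      by (rule has_field_derivative_transform_within_open[of _ _ _ "{..<\<nu>}"]) (use 1 in \<open>auto simp: P_def\<close>)
    then show ?thesis by blast
  next
    case 2
    have "DERIV P_L \<mu> :> - (s_L \<mu> + \<mu>) / a"
      using P_L_deriv[of \<mu>] 2 assms at_within_interior[of \<mu> "{L s_tang..}"] by (simp add: interior_real_atLeast)
    then have "DERIV (P \<nu>) \<mu> :> - (s_L \<mu> + \<mu>) / a"
      by (rule has_field_derivative_transform_within_open[of _ _ _ "{\<nu><..}"]) (use 2 in \<open>auto simp: P_def\<close>)
    then show ?thesis by blast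
  qed
  then show "P \<nu> differentiable at \<mu>" by (auto simp: real_differentiable_def)
qed

text \<open>
  At the crossing the left derivative is that of \<open>P_R\<close> and the right derivative that of \<open>P_L\<close>; they
  differ by \<open>s_R_less_s_L\<close>.
\<close>

lemma P_not_differentiable:
  assumes "L s_tang < \<nu>" "\<nu> < a * N 0" "P_R \<nu> = P_L \<nu>" "open U" "\<nu> \<in> U"
  shows "\<not> P \<nu> differentiable_on U"
proof
  assume "P \<nu> differentiable_on U"
  then have "P \<nu> differentiable at \<nu>"
    using assms by (simp add: differentiable_on_eq_differentiable_at)
  then obtain D where D: "(P \<nu> has_field_derivative D) (at \<nu>)"
    by (auto simp: real_differentiable_def)
  have unique: "X = D" if S: "at \<nu> within S \<noteq> bot" and eq: "\<And>x. x \<in> S \<Longrightarrow> P \<nu> x = p x"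
    and "\<nu> \<in> S" and p: "(p has_field_derivative X) (at \<nu> within S)" for S p X
  proof -
    have "(P \<nu> has_field_derivative D) (at \<nu> within S)" using D by (rule has_field_derivative_at_within)
    moreover have "(P \<nu> has_field_derivative X) (at \<nu> within S)"
      by (rule has_field_derivative_transform_within[OF p, of 1]) (use that in auto)
    ultimately show ?thesis
      unfolding has_field_derivative_iff using S tendsto_unique by blast
  qed
  have "- (s_R \<nu> + \<nu>) / a = D"
  proof (rule unique)
    show "(P_R has_field_derivative - (s_R \<nu> + \<nu>) / a) (at \<nu> within {..\<nu>})"
      by (rule DERIV_subset[OF P_R_deriv]) (use assms in auto)
    show "at \<nu> within {..\<nu>} \<noteq> bot"
    proof
      assume "at \<nu> within {..\<nu>} = bot"
      moreover have "at_left \<nu> \<le> at \<nu> within {..\<nu>}" by (rule at_le) auto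
      ultimately show False by (simp add: bot_unique)
    qed
  qed (auto simp: P_def)
  moreover have "- (s_L \<nu> + \<nu>) / a = D"
  proof (rule unique)
    show "(P_L has_field_derivative - (s_L \<nu> + \<nu>) / a) (at \<nu> within {\<nu>..})"
      by (rule DERIV_subset[OF P_L_deriv]) (use assms in auto)
    show "at \<nu> within {\<nu>..} \<noteq> bot"
    proof
      assume "at \<nu> within {\<nu>..} = bot"
      moreover have "at_right \<nu> \<le> at \<nu> within {\<nu>..}" by (rule at_le) auto
      ultimately show False by (simp add: bot_unique)
    qed
  qed (use assms in \<open>auto simp: P_def\<close>)
  ultimately have "- (s_R \<nu> + \<nu>) / a = - (s_L \<nu> + \<nu>) / a" by (simp only:)
  then show False using s_R_less_s_L[of \<nu>] assms a_pos by simp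
qed

end

section \<open>The tree function\<close>

lemma ln_less_minus_one: "0 < x \<Longrightarrow> x \<noteq> 1 \<Longrightarrow> ln x < x - (1::real)"
  using ln_le_minus_one[of x] ln_eq_minus_one[of x] by linarith

text \<open>
  The tree function of combinatorics, \<open>\<Sum> n\<^sup>n\<^sup>-\<^sup>1 z\<^sup>n / n!\<close>, is the inverse of \<open>t \<mapsto> t exp (- t)\<close> on
  \<open>[0, 1]\<close>. It is the positive, increasing counterpart of \<open>lambert_W0\<close> on the negative axis.
\<close>

definition tree :: "real \<Rightarrow> real" where "tree z = - lambert_W0 (- z)"

lemma DERIV_mult_exp: "((\<lambda>t. t * exp (- t)) has_field_derivative (1 - t) * exp (- t)) (at (t::real))"
  by (auto intro!: derivative_eq_intros simp: algebra_simps)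

lemma mult_exp_less:
  assumes "s < t" "t \<le> 1" shows "s * exp (- s) < t * exp (- (t::real))"
proof (rule DERIV_pos_imp_increasing_open[OF assms(1)])
  show "\<exists>y. ((\<lambda>t. t * exp (- t)) has_real_derivative y) (at x) \<and> 0 < y" if "s < x" "x < t" for x
    using DERIV_mult_exp[of x] that assms by force
qed (auto intro!: continuous_intros)

lemma tree_of_mult_exp:
  assumes "t \<le> 1" shows "tree (t * exp (- t)) = t"
proof -
  have "inj_on (\<lambda>w::real. w * exp w) {-1..}"
  proof (rule linorder_inj_onI)
    show "x * exp x \<noteq> y * exp y" if "x < y" "x \<in> {-1..}" "y \<in> {-1..}" for x y :: real
      using mult_exp_less[of "- y" "- x"] that by auto
  qed auto
  then have "lambert_W0 ((- t) * exp (- t)) = - t"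
    unfolding lambert_W0_def by (rule the_inv_into_f_f) (use assms in auto)
  then show ?thesis by (simp add: tree_def)
qed

lemma obtain_tree:
  assumes "0 \<le> z" "z \<le> exp (- 1)"
  obtains t where "0 \<le> t" "t \<le> 1" "z = t * exp (- t)" "tree z = t"
proof -
  have "\<exists>t. 0 \<le> t \<and> t \<le> 1 \<and> t * exp (- t) = z"
    by (rule IVT') (use assms in \<open>auto intro!: continuous_intros\<close>)
  then show ?thesis using that tree_of_mult_exp by blast
qed

lemma tree_bounds:
  assumes "0 \<le> z" "z \<le> exp (- 1)"
  shows tree_nonneg: "0 \<le> tree z" and tree_le_1: "tree z \<le> 1"
    and tree_mult_exp: "tree z * exp (- tree z) = z"
  using obtain_tree[OF assms] by metis+

lemma tree_less:
  assumes "0 \<le> y" "y < z" "z \<le> exp (- 1)" shows "tree y < tree z"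
proof (rule ccontr)
  assume "\<not> tree y < tree z"
  then have "tree z * exp (- tree z) \<le> tree y * exp (- tree y)"
    using mult_exp_less[of "tree z" "tree y"] tree_le_1[of y] assms by (cases "tree z = tree y") auto
  then show False using assms by (simp add: tree_mult_exp)
qed

lemma tree_pos: "0 < z \<Longrightarrow> z \<le> exp (- 1) \<Longrightarrow> 0 < tree z"
  using tree_less[of 0 z] tree_nonneg[of 0] by simp

lemma tree_le:
  assumes "0 \<le> z" "z \<le> exp (- 1)" shows "tree z \<le> exp 1 * z"
proof -
  have "tree z = z * exp (tree z)"
    using tree_mult_exp[OF assms] by (metis exp_minus_inverse mult.assoc mult.commute mult.right_neutral)
  also have "\<dots> \<le> z * exp 1" using assms tree_le_1[OF assms] by (intro mult_left_mono) auto
  finally show ?thesis by (simp add: mult.commute)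
qed

lemma tree_diff_ge:
  assumes "0 \<le> y" "y \<le> z" "z \<le> exp (- 1)" shows "z - y \<le> tree z - tree y"
proof -
  have y: "y \<le> exp (- 1)" using assms by simp
  define s t where "s = tree y" and "t = tree z"
  have st: "0 \<le> s" "s \<le> t" "t \<le> 1" "y = s * exp (- s)" "z = t * exp (- t)"
    using tree_bounds[of y] tree_bounds[of z] assms y tree_less[of y z] by (cases "y = z"; simp add: s_def t_def)+
  have "t * exp (- t) \<le> t * exp (- s)" using st by (intro mult_left_mono) auto
  moreover have "(t - s) * exp (- s) \<le> (t - s) * 1" using st by (intro mult_left_mono) auto
  ultimately have "t * exp (- t) - s * exp (- s) \<le> t - s" by (simp add: algebra_simps)
  then show ?thesis unfolding s_def[symmetric] t_def[symmetric] using st(4,5) by linarith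
qed

lemma tree_continuous: "continuous_on {0..exp (- 1)} tree"
proof -
  have "continuous_on ((\<lambda>t. t * exp (- t)) ` {0..1}) tree"
    by (rule continuous_on_inv) (auto simp: tree_of_mult_exp intro!: continuous_intros)
  moreover have "{0..exp (- 1)} \<subseteq> (\<lambda>t. t * exp (- t)) ` {0..1::real}"
  proof
    fix z :: real assume "z \<in> {0..exp (- 1)}"
    then obtain t where "0 \<le> t" "t \<le> 1" "z = t * exp (- t)" using obtain_tree[of z] by auto
    then show "z \<in> (\<lambda>t. t * exp (- t)) ` {0..1::real}" by auto
  qed
  ultimately show ?thesis by (rule continuous_on_subset)
qed

lemma ln_tree:
  assumes "0 < z" "z \<le> exp (- 1)" shows "ln (tree z) - tree z = ln z"
proof -
  have "ln z = ln (tree z * exp (- tree z))" using tree_mult_exp[of z] assms by simp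
  also have "\<dots> = ln (tree z) - tree z" using tree_pos[OF assms] by (simp add: ln_mult)
  finally show ?thesis by simp
qed

text \<open>
  The inverse of \<open>tree \<circ> exp\<close> is \<open>t \<mapsto> ln t - t\<close>, which is strictly concave and increasing on
  \<open>(0, 1]\<close>; so \<open>tree \<circ> exp\<close> is strictly convex up to \<open>- 1\<close>.
\<close>

lemma tree_exp_strictly_convex:
  assumes "u < v" "v \<le> - 1" "0 < l" "l < (1::real)"
  shows "tree (exp ((1 - l) * v + l * u)) < (1 - l) * tree (exp v) + l * tree (exp u)"
proof -
  define s t where "s = tree (exp u)" and "t = tree (exp v)"
  define m where "m = (1 - l) * t + l * s"
  have st: "0 < s" "s < t" "t \<le> 1"
    using assms tree_pos[of "exp u"] tree_less[of "exp u" "exp v"] tree_le_1[of "exp v"] by (auto simp: s_def t_def)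
  have eq: "ln s - s = u" "ln t - t = v"
    using assms ln_tree[of "exp u"] ln_tree[of "exp v"] by (auto simp: s_def t_def)
  have mt: "m < t" using st assms mult_strict_left_mono[of s t l] by (simp add: m_def algebra_simps)
  have sm: "s < m" using st assms mult_strict_left_mono[of s t "1 - l"] by (simp add: m_def algebra_simps)
  have lnm: "ln y < ln m + (y - m) / m" if "0 < y" "y \<noteq> m" for y
  proof -
    have "y / m \<noteq> 1" using that sm st by (auto simp: field_simps)
    then have "ln (y / m) < y / m - 1" using that sm st by (intro ln_less_minus_one) auto
    then show ?thesis using that sm st by (simp add: ln_div diff_divide_distrib)
  qed
  have "(1 - l) * ln t + l * ln s < (1 - l) * (ln m + (t - m) / m) + l * (ln m + (s - m) / m)"
    using lnm[of t] lnm[of s] st sm mt assms by (intro add_strict_mono mult_strict_left_mono) auto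
  also have "\<dots> = ln m + ((1 - l) * t + l * s - m) / m"
    using sm st by (simp add: field_simps)
  also have "\<dots> = ln m" by (simp add: m_def)
  finally have "(1 - l) * v + l * u < ln m - m"
    unfolding eq[symmetric] m_def[of] by (simp add: algebra_simps m_def)
  then have "exp ((1 - l) * v + l * u) < exp (ln m - m)" by simp
  also have em: "exp (ln m - m) = m * exp (- m)" using sm st by (simp add: exp_diff exp_minus field_simps)
  finally have "tree (exp ((1 - l) * v + l * u)) < tree (m * exp (- m))"
    using mult_exp_less[of m 1] mt st by (intro tree_less) auto
  also have "\<dots> = m" using mt st by (intro tree_of_mult_exp) auto
  finally show ?thesis by (simp add: m_def s_def t_def)
qed

lemma tree_deriv:
  assumes "0 < z" "z < exp (- 1)"
  shows "(tree has_field_derivative tree z / (z * (1 - tree z))) (at z)" and "tree z < 1"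
proof -
  have t1: "tree (exp (- 1)) = 1" using tree_of_mult_exp[of 1] by simp
  show lt: "tree z < 1" using tree_less[of z "exp (- 1)"] assms t1 by simp
  have "(tree has_field_derivative inverse ((1 - tree z) * exp (- tree z))) (at z)"
  proof (rule DERIV_inverse_function[of "\<lambda>t. t * exp (- t)" _ _ _ 0 "exp (- 1)"])
    show "isCont tree z"
      using continuous_on_interior[OF tree_continuous, of z] assms by simp
  qed (use assms lt DERIV_mult_exp tree_mult_exp in auto)
  moreover have "inverse ((1 - tree z) * exp (- tree z)) = tree z / (z * (1 - tree z))"
  proof -
    define t where "t = tree z"
    have "z = t * exp (- t)" "0 < t" using tree_mult_exp[of z] tree_pos[of z] assms by (auto simp: t_def)
    then show ?thesis unfolding t_def[symmetric] by (simp add: divide_simps)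
  qed
  ultimately show "(tree has_field_derivative tree z / (z * (1 - tree z))) (at z)" by simp
qed

text \<open>
  The right-hand side has derivative \<open>(ln y - y) - (ln t - t)\<close> in \<open>y\<close>, where \<open>t = tree z\<close>. Its sign
  is that of \<open>y - t\<close> because \<open>ln y - y\<close> is increasing on \<open>(0, 1]\<close>. Beyond \<open>1\<close> this monotonicity
  fails, which is why larger entries have to be truncated first.
\<close>

lemma tree_variational:
  assumes z: "0 < z" "z \<le> exp (- 1)" and y: "0 \<le> y" "y \<le> 1" "y \<noteq> tree z"
  shows "(tree z)\<^sup>2 / 2 - tree z < y * (ln (y / z) - 1) - y\<^sup>2 / 2"
proof (cases "y = 0")
  case True
  have "(tree z)\<^sup>2 \<le> 1 * tree z" unfolding power2_eq_square
    using tree_le_1[of z] tree_pos[OF z] z by (intro mult_right_mono) auto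
  then show ?thesis using True tree_pos[OF z] by simp
next
  case False
  define t where "t = tree z"
  have t: "0 < t" "t \<le> 1" "z = t * exp (- t)"
    using tree_pos[OF z] tree_le_1[of z] tree_mult_exp[of z] z by (auto simp: t_def)
  define f where "f x = x * (ln x - ln t + t - 1) - x\<^sup>2 / 2" for x
  have D: "(f has_field_derivative (ln x - x) - (ln t - t)) (at x)" if "0 < x" for x
    unfolding f_def using that by (auto intro!: derivative_eq_intros simp: field_simps)
  have mono: "ln u - u < ln v - v" if "0 < u" "u < v" "v \<le> 1" for u v :: real
  proof -
    have "ln (u / v) < u / v - 1" using that by (intro ln_less_minus_one) auto
    then have "ln u - ln v < (u - v) / v" using that by (simp add: ln_div diff_divide_distrib)
    also have "\<dots> \<le> u - v" using that by (simp add: divide_simps mult_left_le)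
    finally show ?thesis by simp
  qed
  have ypos: "0 < y" using False y by simp
  have "f t < f y"
  proof (cases "t < y")
    case True
    show ?thesis
    proof (rule DERIV_pos_imp_increasing_open[OF True])
      show "\<exists>d. (f has_real_derivative d) (at x) \<and> 0 < d" if "t < x" "x < y" for x
        using D[of x] mono[of t x] that t y by force
      show "continuous_on {t..y} f"
        using D t by (intro DERIV_atLeastAtMost_imp_continuous_on) (meson less_le_trans)
    qed
  next
    case False
    then have True: "y < t" using y by (simp add: t_def)
    show ?thesis
    proof (rule DERIV_neg_imp_decreasing_open[OF True])
      show "\<exists>d. (f has_real_derivative d) (at x) \<and> d < 0" if "y < x" "x < t" for x
        using D[of x] mono[of x t] that t ypos by force
      show "continuous_on {y..t} f"
        using D ypos by (intro DERIV_atLeastAtMost_imp_continuous_on) (meson less_le_trans)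
    qed
  qed
  moreover have "f t = t\<^sup>2 / 2 - t" by (simp add: f_def power2_eq_square algebra_simps)
  moreover have "f y = y * (ln (y / z) - 1) - y\<^sup>2 / 2"
    using t ypos by (simp add: f_def ln_div ln_mult algebra_simps)
  ultimately show ?thesis by (simp add: t_def)
qed

lemma tree_variational_eq:
  assumes z: "0 < z" "z \<le> exp (- 1)"
  shows "tree z * (ln (tree z / z) - 1) - (tree z)\<^sup>2 / 2 = (tree z)\<^sup>2 / 2 - tree z"
  using ln_tree[OF z] tree_pos[OF z] z by (simp add: ln_div power2_eq_square algebra_simps)

section \<open>Series\<close>

lemma suminf_ereal_eq_PInfty:
  fixes g c :: "nat \<Rightarrow> real"
  assumes c: "summable c" and lower: "\<And>k. - c k \<le> g k" and div: "\<not> summable g"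
  shows "(\<Sum>k. ereal (g k)) = \<infinity>"
proof -
  define h where "h k = g k + c k" for k
  have h: "0 \<le> h k" for k using lower[of k] by (simp add: h_def)
  have "\<not> summable h"
    using div c summable_diff[of h c] by (auto simp: h_def)
  then have "(\<Sum>k. ereal (h k)) = \<infinity>" using summable_ereal[of h] h by auto
  then have "(\<lambda>n. \<Sum>k<n. ereal (h k)) \<longlonglongrightarrow> \<infinity>"
    using summable_LIMSEQ[OF summable_ereal_pos[of "\<lambda>k. ereal (h k)"]] h by simp
  moreover have "(\<lambda>n. \<Sum>k<n. ereal (c k)) \<longlonglongrightarrow> ereal (suminf c)"
    using c by (simp add: summable_LIMSEQ)
  ultimately have "(\<lambda>n. (\<Sum>k<n. ereal (h k)) - (\<Sum>k<n. ereal (c k))) \<longlonglongrightarrow> \<infinity> - ereal (suminf c)"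
    by (rule tendsto_diff_ereal_general) simp
  then have "(\<lambda>k. ereal (g k)) sums \<infinity>"
    by (simp add: sums_def h_def sum.distrib)
  then show ?thesis by (rule sums_unique[symmetric])
qed

text \<open>
  Each \<open>r k\<close> is at most the whole sum, so \<open>(r k)\<^sup>2\<close> is at most \<open>suminf r * r k\<close>.
\<close>

lemma suminf_square_le:
  fixes r :: "nat \<Rightarrow> real"
  assumes r: "summable r" "\<And>k. 0 \<le> r k"
  shows "summable (\<lambda>k. (r k)\<^sup>2)" "(\<Sum>k. (r k)\<^sup>2) \<le> (suminf r)\<^sup>2"
proof -
  have le: "(r k)\<^sup>2 \<le> suminf r * r k" for k
    using sum_le_suminf[OF r(1), of "{k}"] r(2) by (simp add: power2_eq_square mult_right_mono)
  have s: "summable (\<lambda>k. suminf r * r k)" using r(1) by (rule summable_mult)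
  show sq: "summable (\<lambda>k. (r k)\<^sup>2)"
    by (rule summable_comparison_test'[OF s, of 0]) (use le in simp)
  have "(\<Sum>k. (r k)\<^sup>2) \<le> (\<Sum>k. suminf r * r k)" by (rule suminf_le[OF le sq s])
  also have "\<dots> = (suminf r)\<^sup>2" using r(1) by (simp add: suminf_mult power2_eq_square)
  finally show "(\<Sum>k. (r k)\<^sup>2) \<le> (suminf r)\<^sup>2" .
qed

lemma suminf_strict_mono:
  fixes f g :: "nat \<Rightarrow> real"
  assumes "summable f" "summable g" "\<And>k. f k < g k" shows "suminf f < suminf g"
proof -
  have "0 < (\<Sum>k. g k - f k)" using assms by (intro suminf_pos summable_diff) auto
  then show ?thesis using suminf_diff[OF assms(2,1)] by simp
qed

lemma summable_of_density:
  assumes "\<And>n. 0 \<le> x n" "summable (\<lambda>k. real (Suc k) * x (Suc k))" shows "summable (x :: nat \<Rightarrow> real)"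
proof -
  have "summable (\<lambda>k. x (Suc k))"
    by (rule summable_comparison_test'[OF assms(2), of 0]) (use assms(1) in \<open>simp add: distrib_right\<close>)
  then show ?thesis by (rule summable_Suc_iff[THEN iffD1])
qed

text \<open>
  In the variable \<open>y = B \<beta> n\<^sup>2 x\<close> the tilted cost of one entry becomes, up to a factor, the function
  minimised in \<open>tree_variational\<close>; the tilt \<open>s\<close> is absorbed in the argument \<open>Z\<close>.
\<close>

lemma scaled_variational:
  fixes x p B n \<beta> s :: real
  assumes "0 \<le> x" "0 < p" "0 < B" "0 < n" "0 < \<beta>"
  defines "y \<equiv> B * \<beta> * n\<^sup>2 * x" and "Z \<equiv> B * \<beta> * n\<^sup>2 * p * exp (- (\<beta> * n * s))"
  shows "x / \<beta> * (ln (x / p) - 1) - B / 2 * (n * x)\<^sup>2 + s * (n * x)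
     = (y * (ln (y / Z) - 1) - y\<^sup>2 / 2) / (B * \<beta>\<^sup>2 * n\<^sup>2)"
proof (cases "x = 0")
  case False
  have ratio: "y / Z = x / p * exp (\<beta> * n * s)"
    using assms by (simp add: exp_minus field_simps)
  have "ln (y / Z) = ln (x / p) + \<beta> * n * s"
    unfolding ratio using assms(1,2) False by (subst ln_mult) auto
  moreover have "x / \<beta> * (l - 1) - B / 2 * (n * x)\<^sup>2 + s * (n * x)
     = (y * (l + \<beta> * n * s - 1) - y\<^sup>2 / 2) / (B * \<beta>\<^sup>2 * n\<^sup>2)" for l
    using assms by (simp add: field_simps power2_eq_square)
  ultimately show ?thesis by simp
qed (simp add: y_def)

section \<open>The density curve of the gas\<close>

locale hyl_gas =
  fixes d :: nat and \<beta> \<alpha> a b :: real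
  assumes d: "3 \<le> d" and \<beta>: "0 < \<beta>" and \<alpha>: "\<alpha> \<le> 0" and b: "0 < b" and b_less_a: "b < a"
    and b_small: "b \<le> 1 / (exp 1 * \<beta> * q d \<beta> \<alpha> 1)"
begin

abbreviation w where "w k \<equiv> q d \<beta> \<alpha> (Suc k)"

definition C where "C = 1 / (4 * pi * \<beta>) powr (real d / 2)"

lemma C_pos: "0 < C" using \<beta> by (simp add: C_def)

lemma w_eq: "w k = exp (\<beta> * real (Suc k) * \<alpha>) * C * real (Suc k) powr (- 1 - real d / 2)"
proof -
  have "real (Suc k) powr (- 1 - real d / 2) = 1 / real (Suc k) powr (1 + real d / 2)"
    by (simp only: powr_minus_divide[symmetric]) simp
  then show ?thesis by (simp add: q_def C_def)
qed

lemma w_pos: "0 < w k" using C_pos by (simp add: w_eq del: of_nat_Suc)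

lemma power_w: "real (Suc k) ^ n * w k = exp (\<beta> * real (Suc k) * \<alpha>) * C * real (Suc k) powr (real n - 1 - real d / 2)"
proof -
  have "real (Suc k) ^ n = real (Suc k) powr real n" by (subst powr_realpow) auto
  moreover have "real (Suc k) powr real n * real (Suc k) powr (- 1 - real d / 2) = real (Suc k) powr (real n - 1 - real d / 2)"
    by (subst powr_add[symmetric]) (simp add: algebra_simps)
  ultimately have "real (Suc k) ^ n * real (Suc k) powr (- 1 - real d / 2) = real (Suc k) powr (real n - 1 - real d / 2)"
    by (simp only:)
  moreover have "real (Suc k) ^ n * (e * C * p) = e * C * (real (Suc k) ^ n * p)" for e p :: real
    by (simp only: mult_ac)
  ultimately show ?thesis unfolding w_eq by (simp only:)
qed

lemma exp_le: "exp (\<beta> * real (Suc k) * \<alpha>) \<le> exp (\<beta> * \<alpha>)"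
proof -
  have "\<beta> * \<alpha> * real (Suc k) \<le> \<beta> * \<alpha> * 1"
    using \<beta> \<alpha> by (intro mult_left_mono_neg) (auto simp: mult_nonneg_nonpos)
  then show ?thesis by (simp add: mult_ac)
qed

text \<open>
  By \<open>\<alpha> \<le> 0\<close> and \<open>d \<ge> 2\<close> the value \<open>k\<^sup>2 q\<^sub>k\<close> is largest at \<open>k = 1\<close>, so the smallness
  condition on \<open>b\<close>, which concerns \<open>q\<^sub>1\<close> only, keeps all arguments of the tree function in \<open>[0, exp (- 1)]\<close>.
\<close>

lemma square_w_le: "(real (Suc k))\<^sup>2 * w k \<le> q d \<beta> \<alpha> 1"
proof -
  have "real (Suc k) powr (real 2 - 1 - real d / 2) \<le> real (Suc k) powr 0"
    using d by (intro powr_mono) auto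
  then have "(real (Suc k))\<^sup>2 * w k \<le> exp (\<beta> * \<alpha>) * C * 1"
    unfolding power_w using exp_le[of k] C_pos by (intro mult_mono) auto
  then show ?thesis by (simp add: q_def C_def)
qed

lemma weight_le: "b * \<beta> * (real (Suc k))\<^sup>2 * w k \<le> exp (- 1)"
proof -
  have q1: "0 < q d \<beta> \<alpha> 1" using w_pos[of 0] by simp
  have "b * \<beta> * ((real (Suc k))\<^sup>2 * w k) \<le> b * \<beta> * q d \<beta> \<alpha> 1"
    using square_w_le[of k] b \<beta> by (intro mult_left_mono) auto
  also have "\<dots> \<le> exp (- 1)"
    using b_small q1 \<beta> by (simp add: field_simps exp_minus)
  finally show ?thesis by (simp add: mult.assoc)
qed

text \<open>
  The terms decay like \<open>k\<close> to the power \<open>- d / 2\<close>, so \<open>d \<ge> 3\<close> is exactly what makes them summable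
  when \<open>\<alpha> = 0\<close>.
\<close>

lemma summable_density_w: "summable (\<lambda>k. real (Suc k) * w k)"
proof (rule summable_comparison_test')
  have "summable (\<lambda>k. real k powr (- 3 / 2))" by (subst summable_real_powr_iff) simp
  then have "summable (\<lambda>k. real (Suc k) powr (- 3 / 2))"
    by (rule summable_Suc_iff[THEN iffD2])
  then show "summable (\<lambda>k. exp (\<beta> * \<alpha>) * C * real (Suc k) powr (- 3 / 2))" by (rule summable_mult)
  show "norm (real (Suc k) * w k) \<le> exp (\<beta> * \<alpha>) * C * real (Suc k) powr (- 3 / 2)" if "k \<ge> 0" for k
  proof -
    have "real (Suc k) powr (real 1 - 1 - real d / 2) \<le> real (Suc k) powr (- 3 / 2)"
      using d by (intro powr_mono) auto
    then have "real (Suc k) ^ 1 * w k \<le> exp (\<beta> * \<alpha>) * C * real (Suc k) powr (- 3 / 2)"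
      unfolding power_w using exp_le[of k] C_pos by (intro mult_mono) auto
    then show ?thesis using w_pos[of k] by simp
  qed
qed

lemma summable_w: "summable w"
proof (rule summable_comparison_test'[OF summable_density_w])
  show "norm (w k) \<le> real (Suc k) * w k" if "k \<ge> 0" for k
    using w_pos[of k] by (simp add: distrib_right)
qed

text \<open>
  Index \<open>k\<close> belongs to cycle length \<open>Suc k\<close>; the tilt \<open>s\<close> acts like a chemical potential \<open>- s\<close>.
\<close>

definition z where "z s k = b * \<beta> * (real (Suc k))\<^sup>2 * w k * exp (- (\<beta> * real (Suc k) * s))"
definition T where "T s k = tree (z s k)"

lemma z_pos: "0 < z s k" using b \<beta> w_pos by (simp add: z_def)

lemma z_antimono: "s \<le> t \<Longrightarrow> z t k \<le> z s k"
  using b \<beta> w_pos[of k] by (simp add: z_def mult_left_mono)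

lemma z_less: "s < t \<Longrightarrow> z t k < z s k"
  using b \<beta> w_pos[of k] by (simp add: z_def)

lemma z_0_le: "z 0 k \<le> exp (- 1)" using weight_le[of k] by (simp add: z_def)

lemma z_le: "0 \<le> s \<Longrightarrow> z s k \<le> exp (- 1)"
  using z_antimono[of 0 s k] z_0_le[of k] by simp

lemma T_pos: "0 \<le> s \<Longrightarrow> 0 < T s k" and T_le_1: "0 \<le> s \<Longrightarrow> T s k \<le> 1"
  using tree_pos[OF z_pos z_le] tree_le_1[OF less_imp_le[OF z_pos] z_le] by (auto simp: T_def)

lemma T_less: "0 \<le> s \<Longrightarrow> s < t \<Longrightarrow> T t k < T s k"
  unfolding T_def using z_pos z_less z_le by (intro tree_less) (auto simp: less_imp_le)

lemma T_over_le: "0 \<le> s \<Longrightarrow> T s k / real (Suc k) \<le> exp 1 * b * \<beta> * (real (Suc k) * w k)"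
proof -
  assume s: "0 \<le> s"
  have "T s k \<le> exp 1 * z s k" unfolding T_def using z_pos z_le[OF s] by (intro tree_le) (auto simp: less_imp_le)
  also have "\<dots> \<le> exp 1 * z 0 k" using z_antimono[OF s] by simp
  also have "\<dots> = exp 1 * b * \<beta> * (real (Suc k) * w k) * real (Suc k)"
    by (simp add: z_def power2_eq_square)
  finally show ?thesis by (simp add: pos_divide_le_eq del: of_nat_Suc)
qed

lemma summable_majorant: "summable (\<lambda>k. exp 1 * b * \<beta> * (real (Suc k) * w k))"
  by (rule summable_mult[OF summable_density_w])

lemma summable_T: assumes "0 \<le> s" shows "summable (\<lambda>k. T s k / real (Suc k))"
proof (rule summable_comparison_test'[OF summable_majorant])
  show "norm (T s k / real (Suc k)) \<le> exp 1 * b * \<beta> * (real (Suc k) * w k)" if "k \<ge> 0" for k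
    using T_over_le[OF assms, of k] T_pos[OF assms, of k] by simp
qed

definition N where "N s = 1 / (b * \<beta>) * (\<Sum>k. T s k / real (Suc k))"

lemma N_nonneg: "0 \<le> s \<Longrightarrow> 0 \<le> N s"
  unfolding N_def using b \<beta> T_pos[of s]
  by (intro mult_nonneg_nonneg suminf_nonneg summable_T) (auto simp: less_imp_le)

lemma N_less:
  assumes "0 \<le> s" "s < t" shows "N t < N s"
proof -
  have "(\<Sum>k. T t k / real (Suc k)) < (\<Sum>k. T s k / real (Suc k))"
    by (rule suminf_strict_mono)
      (use assms T_less in \<open>auto intro!: summable_T divide_strict_right_mono simp del: of_nat_Suc\<close>)
  then show ?thesis unfolding N_def using b \<beta> by (intro mult_strict_left_mono) auto
qed

lemma z_exp: "z s k = exp (ln (b * \<beta> * (real (Suc k))\<^sup>2 * w k) - \<beta> * real (Suc k) * s)"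
  using b \<beta> w_pos[of k] by (simp add: z_def exp_diff exp_minus field_simps del: of_nat_Suc)

lemma N_strictly_convex:
  assumes "0 \<le> s" "s < t" "0 < l" "l < 1"
  shows "N ((1 - l) * s + l * t) < (1 - l) * N s + l * N t"
proof -
  define m where "m = (1 - l) * s + l * t"
  have m: "0 \<le> m" using assms by (simp add: m_def)
  have conv: "T m k < (1 - l) * T s k + l * T t k" for k
  proof -
    define u where "u x = ln (b * \<beta> * (real (Suc k))\<^sup>2 * w k) - \<beta> * real (Suc k) * x" for x
    have zu: "z x k = exp (u x)" for x by (simp only: u_def z_exp)
    have "u t < u s" using assms \<beta> by (simp add: u_def del: of_nat_Suc)
    moreover have "u s \<le> - 1" using z_le[OF assms(1), of k] by (simp add: zu)
    moreover have "u m = (1 - l) * u s + l * u t" by (simp add: u_def m_def algebra_simps)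
    ultimately show ?thesis
      using tree_exp_strictly_convex[of "u t" "u s" l] assms by (simp add: T_def zu)
  qed
  have st: "0 \<le> s" "0 \<le> t" using assms by auto
  have "(\<Sum>k. T m k / real (Suc k)) < (\<Sum>k. (1 - l) * (T s k / real (Suc k)) + l * (T t k / real (Suc k)))"
  proof (rule suminf_strict_mono)
    show "T m k / real (Suc k) < (1 - l) * (T s k / real (Suc k)) + l * (T t k / real (Suc k))" for k
      using divide_strict_right_mono[OF conv[of k], of "real (Suc k)"] by (simp add: add_divide_distrib)
  qed (intro summable_add summable_mult summable_T m st)+
  also have "\<dots> = (1 - l) * (\<Sum>k. T s k / real (Suc k)) + l * (\<Sum>k. T t k / real (Suc k))"
    by (simp only: suminf_add[symmetric] suminf_mult summable_mult summable_T st)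
  finally have "1 / (b * \<beta>) * (\<Sum>k. T m k / real (Suc k))
      < 1 / (b * \<beta>) * ((1 - l) * (\<Sum>k. T s k / real (Suc k)) + l * (\<Sum>k. T t k / real (Suc k)))"
    using b \<beta> by (intro mult_strict_left_mono) auto
  then show ?thesis
    unfolding m_def[symmetric] N_def by (simp only: distrib_left mult.left_commute[of "1 / (b * \<beta>)"])
qed

lemma N_cont: "continuous_on {0..} N"
proof -
  have "uniform_limit {0..} (\<lambda>n s. \<Sum>k<n. T s k / real (Suc k)) (\<lambda>s. \<Sum>k. T s k / real (Suc k)) sequentially"
    by (rule Weierstrass_m_test[OF _ summable_majorant])
      (use T_over_le T_pos in \<open>auto simp: less_imp_le abs_of_nonneg simp del: of_nat_Suc\<close>)
  moreover have "continuous_on {0..} (\<lambda>s. T s k)" for k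
    unfolding T_def
  proof (rule continuous_on_compose2[OF tree_continuous])
    show "continuous_on {0..} (\<lambda>s. z s k)" unfolding z_def by (intro continuous_intros)
    show "(\<lambda>s. z s k) ` {0..} \<subseteq> {0..exp (- 1)}"
      using z_pos z_le by (auto simp: less_imp_le)
  qed
  ultimately have "continuous_on {0..} (\<lambda>s. \<Sum>k. T s k / real (Suc k))"
    by (intro uniform_limit_theorem[where F = sequentially]) (auto intro!: always_eventually continuous_on_sum continuous_on_divide continuous_on_const simp del: of_nat_Suc)
  then show ?thesis unfolding N_def by (intro continuous_intros)
qed

lemma h_tilde_eq:
  assumes "x \<le> 0" shows "h_tilde d \<beta> \<alpha> a b x = N (- (a * b / (a - b)) * x)"
proof -
  have "lambert_W0 (- b * \<beta> * (real (Suc k))\<^sup>2 * w k * exp (a * b / (a - b) * \<beta> * real (Suc k) * x))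
      = - T (- (a * b / (a - b)) * x) k" for k
  proof -
    have "a * b / (a - b) * \<beta> * real (Suc k) * x = - (\<beta> * real (Suc k) * (- (a * b / (a - b)) * x))"
      by (simp add: mult_ac)
    then have "- b * \<beta> * (real (Suc k))\<^sup>2 * w k * exp (a * b / (a - b) * \<beta> * real (Suc k) * x) =
        - z (- (a * b / (a - b)) * x) k" by (simp only: z_def mult_minus_left)
    then show ?thesis by (simp only: T_def tree_def minus_minus)
  qed
  then have "h_tilde d \<beta> \<alpha> a b x = - (1 / (b * \<beta>)) * (\<Sum>k. - (T (- (a * b / (a - b)) * x) k / real (Suc k)))"
    unfolding h_tilde_def by simp
  also have "\<dots> = N (- (a * b / (a - b)) * x)"
  proof -
    have "0 \<le> - (a * b / (a - b)) * x"
      using assms b b_less_a by (intro mult_nonpos_nonpos) auto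
    then show ?thesis unfolding N_def using suminf_minus[OF summable_T] by simp
  qed
  finally show ?thesis .
qed

section \<open>Duality in the box and truncation\<close>

text \<open>
  \<open>\<psi> s k\<close> is the minimal tilted cost of cycle length \<open>Suc k\<close> and \<open>\<xi> s\<close> the sequence of minimisers.
  \<open>ent\<close> is an entropy term together with its share of the quadratic term.
\<close>

definition \<psi> where "\<psi> s k = ((T s k)\<^sup>2 / 2 - T s k) / (b * \<beta>\<^sup>2 * (real (Suc k))\<^sup>2)"
definition \<Psi> where "\<Psi> s = (\<Sum>k. \<psi> s k) + q_bar d \<beta> \<alpha> / \<beta>"
definition \<xi> where "\<xi> s n = (case n of 0 \<Rightarrow> 0 | Suc k \<Rightarrow> T s k / (b * \<beta> * (real (Suc k))\<^sup>2))"

definition cost where "cost x k = x (Suc k) / \<beta> * (ln (x (Suc k) / w k) - 1)"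
definition ent where "ent x k = cost x k - b / 2 * (real (Suc k) * x (Suc k))\<^sup>2"
definition D where "D x = (\<Sum>k. real (Suc k) * x (Suc k))"
definition e where "e x = (\<Sum>k. ent x k) + q_bar d \<beta> \<alpha> / \<beta>"
definition finite_energy where
  "finite_energy x \<longleftrightarrow> x \<in> l1_plus \<and> summable (\<lambda>k. real (Suc k) * x (Suc k)) \<and> summable (cost x)"
definition box where "box x \<longleftrightarrow> (\<forall>k. b * \<beta> * (real (Suc k))\<^sup>2 * x (Suc k) \<le> 1)"

lemma ent_tilted:
  assumes "0 \<le> x (Suc k)"
  defines "y \<equiv> b * \<beta> * (real (Suc k))\<^sup>2 * x (Suc k)"
  shows "ent x k + s * (real (Suc k) * x (Suc k)) = (y * (ln (y / z s k) - 1) - y\<^sup>2 / 2) / (b * \<beta>\<^sup>2 * (real (Suc k))\<^sup>2)"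
  unfolding ent_def cost_def y_def z_def
  by (rule scaled_variational) (use assms w_pos b \<beta> in auto)

lemma ent_ge:
  assumes s: "0 \<le> s" and x: "0 \<le> x (Suc k)" "b * \<beta> * (real (Suc k))\<^sup>2 * x (Suc k) \<le> 1"
  shows "x (Suc k) \<noteq> \<xi> s (Suc k) \<Longrightarrow> \<psi> s k < ent x k + s * (real (Suc k) * x (Suc k))"
    and "x (Suc k) = \<xi> s (Suc k) \<Longrightarrow> ent x k + s * (real (Suc k) * x (Suc k)) = \<psi> s k"
proof -
  define y where "y = b * \<beta> * (real (Suc k))\<^sup>2 * x (Suc k)"
  have pos: "0 < b * \<beta>\<^sup>2 * (real (Suc k))\<^sup>2" "0 < b * \<beta> * (real (Suc k))\<^sup>2" using b \<beta> by auto
  have iff: "y = T s k \<longleftrightarrow> x (Suc k) = \<xi> s (Suc k)"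
  proof -
    have "c * v = t \<longleftrightarrow> v = t / c" if "0 < c" for c v t :: real using that by (auto simp: field_simps)
    from this[OF pos(2)] show ?thesis by (simp add: y_def \<xi>_def)
  qed
  have y: "0 \<le> y" "y \<le> 1" using x pos(2) by (auto simp: y_def)
  show "\<psi> s k < ent x k + s * (real (Suc k) * x (Suc k))" if "x (Suc k) \<noteq> \<xi> s (Suc k)"
    unfolding ent_tilted[where x = x and k = k, OF x(1)] \<psi>_def y_def[symmetric]
    using tree_variational[OF z_pos z_le[OF s] y] that iff pos(1)
    by (intro divide_strict_right_mono) (auto simp: T_def)
  show "ent x k + s * (real (Suc k) * x (Suc k)) = \<psi> s k" if "x (Suc k) = \<xi> s (Suc k)"
    unfolding ent_tilted[where x = x and k = k, OF x(1)] \<psi>_def y_def[symmetric]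
    using tree_variational_eq[OF z_pos z_le[OF s]] that iff by (simp add: T_def)
qed

lemma summable_ent: "finite_energy x \<Longrightarrow> summable (ent x)"
  unfolding ent_def finite_energy_def l1_plus_def
  by (intro summable_diff summable_mult suminf_square_le) auto

lemma summable_\<psi>: assumes "0 \<le> s" shows "summable (\<psi> s)"
proof (rule summable_comparison_test')
  show "summable (\<lambda>k. 1 / (b * \<beta>\<^sup>2) * (T s k / real (Suc k)))" by (rule summable_mult[OF summable_T[OF assms]])
  show "norm (\<psi> s k) \<le> 1 / (b * \<beta>\<^sup>2) * (T s k / real (Suc k))" if "k \<ge> 0" for k
  proof -
    have "\<bar>(T s k)\<^sup>2 / 2 - T s k\<bar> \<le> T s k"
      using T_pos[OF assms, of k] T_le_1[OF assms, of k] mult_left_le[of "T s k" "T s k"]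
      by (simp add: power2_eq_square abs_le_iff)
    moreover have "b * \<beta>\<^sup>2 * real (Suc k) \<le> b * \<beta>\<^sup>2 * (real (Suc k))\<^sup>2"
      using b \<beta> by (intro mult_left_mono) (auto simp: power2_eq_square)
    ultimately have "\<bar>(T s k)\<^sup>2 / 2 - T s k\<bar> / (b * \<beta>\<^sup>2 * (real (Suc k))\<^sup>2) \<le> T s k / (b * \<beta>\<^sup>2 * real (Suc k))"
      using b \<beta> T_pos[OF assms, of k] by (intro frac_le) auto
    then show ?thesis using b \<beta> by (simp add: \<psi>_def abs_mult)
  qed
qed

lemma \<xi>_Suc: "real (Suc k) * \<xi> s (Suc k) = 1 / (b * \<beta>) * (T s k / real (Suc k))"
  by (simp add: \<xi>_def power2_eq_square)

lemma \<xi>_box: "0 \<le> s \<Longrightarrow> box (\<xi> s)"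
  unfolding box_def \<xi>_def using T_le_1 b \<beta> by simp

lemma \<xi>_nonneg: "0 \<le> s \<Longrightarrow> 0 \<le> \<xi> s n"
  unfolding \<xi>_def using T_pos[of s] b \<beta> by (auto split: nat.split simp: less_imp_le)

lemma \<xi>_summable: "0 \<le> s \<Longrightarrow> summable (\<lambda>k. real (Suc k) * \<xi> s (Suc k))"
  unfolding \<xi>_Suc by (intro summable_mult summable_T)

lemma \<xi>_ent: "0 \<le> s \<Longrightarrow> ent (\<xi> s) k = \<psi> s k - s * (real (Suc k) * \<xi> s (Suc k))"
  using ent_ge(2)[of s "\<xi> s" k] \<xi>_nonneg[of s "Suc k"] \<xi>_box[of s] by (simp add: box_def)

lemma \<xi>_finite_energy: assumes "0 \<le> s" shows "finite_energy (\<xi> s)"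
proof -
  have "summable (\<lambda>k. (\<psi> s k - s * (real (Suc k) * \<xi> s (Suc k))) + b / 2 * (real (Suc k) * \<xi> s (Suc k))\<^sup>2)"
    using assms \<xi>_nonneg[OF assms]
    by (intro summable_add summable_diff summable_mult summable_\<psi> \<xi>_summable suminf_square_le) auto
  then have "summable (cost (\<xi> s))"
    unfolding \<xi>_ent[OF assms, symmetric] ent_def by simp
  then show ?thesis
    unfolding finite_energy_def l1_plus_def
    using \<xi>_summable[OF assms] \<xi>_nonneg[OF assms] summable_of_density[of "\<xi> s"] by (auto simp: \<xi>_def)
qed

lemma D_\<xi>: "0 \<le> s \<Longrightarrow> D (\<xi> s) = N s"
  unfolding D_def N_def \<xi>_Suc by (intro suminf_mult summable_T)

lemma e_tilted:
  assumes "finite_energy x"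
  shows "e x + s * D x = (\<Sum>k. ent x k + s * (real (Suc k) * x (Suc k))) + q_bar d \<beta> \<alpha> / \<beta>"
    and "summable (\<lambda>k. ent x k + s * (real (Suc k) * x (Suc k)))"
proof -
  have 1: "summable (\<lambda>k. real (Suc k) * x (Suc k))" using assms by (simp add: finite_energy_def)
  show "e x + s * D x = (\<Sum>k. ent x k + s * (real (Suc k) * x (Suc k))) + q_bar d \<beta> \<alpha> / \<beta>"
    unfolding e_def D_def
    by (subst suminf_add[symmetric]) (use 1 summable_ent[OF assms] in \<open>auto simp: suminf_mult summable_mult\<close>)
  show "summable (\<lambda>k. ent x k + s * (real (Suc k) * x (Suc k)))"
    using 1 summable_ent[OF assms] by (intro summable_add summable_mult)
qed

lemma e_\<xi>: "0 \<le> s \<Longrightarrow> e (\<xi> s) + s * D (\<xi> s) = \<Psi> s"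
  using e_tilted(1)[OF \<xi>_finite_energy, of s s] by (simp add: \<xi>_ent \<Psi>_def)

text \<open>
  Weak duality with its equality case, obtained by summing the bounds for the single entries: a sum of
  nonnegative differences vanishes only if each of them does.
\<close>

lemma e_ge_\<Psi>:
  assumes s: "0 \<le> s" and x: "finite_energy x" "box x"
  shows "\<Psi> s \<le> e x + s * D x" and "\<Psi> s = e x + s * D x \<Longrightarrow> x = \<xi> s"
proof -
  have x0: "x 0 = 0" "\<And>n. 0 \<le> x n" using x by (auto simp: finite_energy_def l1_plus_def)
  have bx: "b * \<beta> * (real (Suc k))\<^sup>2 * x (Suc k) \<le> 1" for k using x by (simp add: box_def)
  note ge = ent_ge[where x = x, OF s x0(2) bx]
  have le: "\<psi> s k \<le> ent x k + s * (real (Suc k) * x (Suc k))" for k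
    using ge[of k] by (cases "x (Suc k) = \<xi> s (Suc k)") auto
  show "\<Psi> s \<le> e x + s * D x"
    unfolding e_tilted(1)[OF x(1)] \<Psi>_def
    using suminf_le[OF le summable_\<psi>[OF s] e_tilted(2)[OF x(1)]] by simp
  assume eq: "\<Psi> s = e x + s * D x"
  have "(\<Sum>k. (ent x k + s * (real (Suc k) * x (Suc k))) - \<psi> s k) = 0"
    using eq e_tilted[OF x(1), of s] suminf_diff[OF e_tilted(2)[OF x(1), of s] summable_\<psi>[OF s]]
    by (simp add: \<Psi>_def)
  then have "(ent x k + s * (real (Suc k) * x (Suc k))) - \<psi> s k = 0" for k
    using suminf_eq_zero_iff[OF summable_diff[OF e_tilted(2)[OF x(1), of s] summable_\<psi>[OF s]]] le by auto
  then have "x (Suc k) = \<xi> s (Suc k)" for k using ge(1)[of k] by fastforce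
  then show "x = \<xi> s" using x0(1) by (intro ext) (metis \<xi>_def nat.case(1) not0_implies_Suc)
qed

lemma \<Psi>_supergradient:
  assumes "0 \<le> s" "0 \<le> t" shows "\<Psi> t \<le> \<Psi> s + (t - s) * N s"
  using e_ge_\<Psi>(1)[OF assms(2) \<xi>_finite_energy[OF assms(1)] \<xi>_box[OF assms(1)]] e_\<xi>[OF assms(1)] D_\<xi>[OF assms(1)]
  by (simp add: algebra_simps)

definition trunc where "trunc x n = (if b * \<beta> * (real n)\<^sup>2 * x n \<le> 1 then x n else 0)" for x :: "nat \<Rightarrow> real"

lemma trunc_box: "box (trunc x)"
  unfolding box_def trunc_def by auto

text \<open>
  Outside the box \<open>x\<^sub>k\<close> exceeds \<open>e q\<^sub>k\<close>, because \<open>e b \<beta> k\<^sup>2 q\<^sub>k \<le> 1\<close>.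
\<close>

lemma cost_pos_of_large:
  assumes "\<not> b * \<beta> * (real (Suc k))\<^sup>2 * x (Suc k) \<le> 1" shows "0 < cost x k"
proof -
  define n where "n = (real (Suc k))\<^sup>2"
  have n: "0 < n" by (simp add: n_def)
  have w: "0 < w k" by (rule w_pos)
  have "exp 1 * (b * \<beta> * n * w k) \<le> exp 1 * exp (- 1)"
    using weight_le[of k] by (simp add: n_def)
  also have "\<dots> = 1" by (simp add: exp_minus)
  also have "1 < b * \<beta> * n * x (Suc k)" using assms by (simp add: n_def)
  finally have "(b * \<beta> * n) * (exp 1 * w k) < (b * \<beta> * n) * x (Suc k)" by (simp add: mult_ac)
  then have less: "exp 1 * w k < x (Suc k)" using b \<beta> n by simp
  then have "exp 1 < x (Suc k) / w k" using w by (simp add: field_simps)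
  then have "ln (exp 1) < ln (x (Suc k) / w k)" by (intro ln_less_cancel_iff[THEN iffD2]) (auto intro: less_trans[OF exp_gt_zero])
  moreover have "0 < x (Suc k)" using less w by (smt (verit) exp_gt_zero mult_pos_pos)
  ultimately show ?thesis using \<beta> by (simp add: cost_def)
qed

text \<open>
  From \<open>ln u \<le> u - 1\<close>. The bound is summable in \<open>k\<close>, so the entropy series converges or diverges to
  \<open>+ \<infinity>\<close>.
\<close>

lemma cost_ge:
  assumes "0 \<le> x (Suc k)" shows "- (w k / \<beta>) \<le> cost x k"
proof (cases "x (Suc k) = 0")
  case True
  then show ?thesis using w_pos[of k] \<beta> by (simp add: cost_def)
next
  case False
  define u where "u = x (Suc k)"
  have u: "0 < u" using False assms by (simp add: u_def)
  have "ln (w k / u) \<le> w k / u - 1" using u w_pos[of k] by (intro ln_le_minus_one) simp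
  then have "1 - w k / u \<le> ln (u / w k)" using u w_pos[of k] by (simp add: ln_div)
  then have "u / \<beta> * (- (w k / u)) \<le> u / \<beta> * (ln (u / w k) - 1)" using u \<beta> by (intro mult_left_mono) auto
  then show ?thesis using u by (simp add: cost_def u_def)
qed

text \<open>
  With \<open>r\<close> the deleted part of the density, deletion changes the quadratic term by
  \<open>b / 2 \<Sum> r\<^sub>k\<^sup>2 \<le> b / 2 (\<Sum> r\<^sub>k)\<^sup>2\<close>. The mean-field part pays for this by \<open>mean_field_remove\<close>, and
  the costs \<open>g\<close> of the deleted entries are a strict gain.
\<close>

lemma trunc_improves:
  assumes x: "finite_energy x"
  shows "finite_energy (trunc x)"
    and "e (trunc x) + mean_field a b \<mu> (D (trunc x)) \<le> e x + mean_field a b \<mu> (D x)"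
    and "\<not> box x \<Longrightarrow> e (trunc x) + mean_field a b \<mu> (D (trunc x)) < e x + mean_field a b \<mu> (D x)"
proof -
  define big where "big k \<longleftrightarrow> \<not> b * \<beta> * (real (Suc k))\<^sup>2 * x (Suc k) \<le> 1" for k
  define r where "r k = (if big k then real (Suc k) * x (Suc k) else 0)" for k
  define g where "g k = (if big k then cost x k else 0)" for k
  have x0: "x 0 = 0" "\<And>n. 0 \<le> x n" "summable (\<lambda>k. real (Suc k) * x (Suc k))" "summable (cost x)"
    using x by (auto simp: finite_energy_def l1_plus_def)
  have r: "0 \<le> r k" for k using x0(2) by (simp add: r_def)
  have sr: "summable r"
    by (rule summable_comparison_test'[OF x0(3), of 0]) (use x0(2) in \<open>simp add: r_def\<close>)
  have g: "0 \<le> g k" for k using cost_pos_of_large[of k x] by (simp add: g_def big_def less_imp_le)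
  have sg: "summable g"
  proof (rule summable_comparison_test')
    show "summable (\<lambda>k. cost x k + w k / \<beta>)"
      by (intro summable_add x0(4) summable_divide summable_w)
    show "norm (g k) \<le> cost x k + w k / \<beta>" if "k \<ge> 0" for k
      using g[of k] cost_ge[of x k] x0(2)[of "Suc k"] w_pos[of k] \<beta> by (auto simp: g_def)
  qed
  have dens: "real (Suc k) * trunc x (Suc k) = real (Suc k) * x (Suc k) - r k" for k
    by (auto simp: trunc_def r_def big_def)
  have costs: "cost (trunc x) k = cost x k - g k" for k
    by (auto simp: cost_def trunc_def g_def big_def)
  have ents: "ent (trunc x) k = ent x k - g k + b / 2 * (r k)\<^sup>2" for k
    unfolding ent_def costs dens by (auto simp: r_def)
  have sr2: "summable (\<lambda>k. (r k)\<^sup>2)" "(\<Sum>k. (r k)\<^sup>2) \<le> (suminf r)\<^sup>2"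
    using suminf_square_le[OF sr r] by auto
  show fin: "finite_energy (trunc x)"
  proof -
    have "summable (\<lambda>k. real (Suc k) * trunc x (Suc k))" unfolding dens by (intro summable_diff x0(3) sr)
    moreover have "0 \<le> trunc x n" for n using x0(2) by (simp add: trunc_def)
    moreover have "summable (cost (trunc x))"
      unfolding costs[abs_def] by (intro summable_diff x0(4) sg)
    ultimately show ?thesis
      using x0(1) summable_of_density[of "trunc x"] by (auto simp: finite_energy_def l1_plus_def trunc_def)
  qed
  have "D (trunc x) = D x - suminf r"
    unfolding D_def dens by (rule suminf_diff[symmetric, OF x0(3) sr])
  moreover have "e (trunc x) = e x - suminf g + b / 2 * (\<Sum>k. (r k)\<^sup>2)"
  proof -
    have "(\<Sum>k. ent (trunc x) k) = (\<Sum>k. ent x k - g k) + (\<Sum>k. b / 2 * (r k)\<^sup>2)"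
      unfolding ents by (rule suminf_add[symmetric]) (intro summable_diff summable_mult summable_ent x sg sr2)+
    then show ?thesis
      using suminf_diff[OF summable_ent[OF x] sg] suminf_mult[OF sr2(1), of "b / 2"] by (simp add: e_def)
  qed
  moreover have "b / 2 * (\<Sum>k. (r k)\<^sup>2) \<le> b / 2 * (suminf r)\<^sup>2" using sr2 b by (intro mult_left_mono) auto
  moreover have "mean_field a b \<mu> (D x - suminf r) + b / 2 * (suminf r)\<^sup>2 \<le> mean_field a b \<mu> (D x)"
    using b b_less_a suminf_nonneg[OF sr r] by (intro mean_field_remove)
  ultimately have main: "e (trunc x) + mean_field a b \<mu> (D (trunc x)) + suminf g \<le> e x + mean_field a b \<mu> (D x)"
    by simp
  then show "e (trunc x) + mean_field a b \<mu> (D (trunc x)) \<le> e x + mean_field a b \<mu> (D x)"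
    using suminf_nonneg[OF sg g] by simp
  assume "\<not> box x"
  then obtain k where "big k" by (auto simp: box_def big_def)
  then have "0 < g k" using cost_pos_of_large[of k x] by (simp add: g_def big_def)
  then have "0 < suminf g" using suminf_pos2[OF sg g] by blast
  then show "e (trunc x) + mean_field a b \<mu> (D (trunc x)) < e x + mean_field a b \<mu> (D x)"
    using main by simp
qed

lemma F_finite:
  assumes x: "finite_energy x"
  shows "F d \<beta> \<alpha> a b \<mu> x = ereal (e x + mean_field a b \<mu> (D x))"
proof -
  have x0: "\<And>n. 0 \<le> x n" "summable (\<lambda>k. real (Suc k) * x (Suc k))" "summable (cost x)"
    using x by (auto simp: finite_energy_def l1_plus_def)
  have td: "total_density x = ereal (D x)"
    unfolding total_density_def D_def by (rule suminf_ereal'[OF x0(2)])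
  have rate: "rate_I d \<beta> \<alpha> x = ereal (suminf (cost x) + q_bar d \<beta> \<alpha> / \<beta>)"
    using suminf_ereal'[OF x0(3)] unfolding rate_I_def cost_def by simp
  have sq: "summable (\<lambda>k. (real (Suc k) * x (Suc k))\<^sup>2)"
    using x0 by (intro suminf_square_le) auto
  have "suminf (ent x) = suminf (cost x) - b / 2 * (\<Sum>k. (real (Suc k) * x (Suc k))\<^sup>2)"
    unfolding ent_def using suminf_diff[OF x0(3) summable_mult[OF sq, of "b / 2"]] suminf_mult[OF sq, of "b / 2"] by simp
  then show ?thesis
    unfolding F_def td rate H_HYL_def e_def mean_field_def by (simp add: power_mult_distrib)
qed

lemma F_infinite:
  assumes x: "x \<in> l1_plus" "\<not> finite_energy x"
  shows "F d \<beta> \<alpha> a b \<mu> x = \<infinity>"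
proof (cases "total_density x = \<infinity>")
  case False
  have x0: "\<And>n. 0 \<le> x n" using x(1) by (auto simp: l1_plus_def)
  have "summable (\<lambda>k. real (Suc k) * x (Suc k))"
    using False x0 unfolding total_density_def by (intro summable_ereal) auto
  then have "\<not> summable (cost x)" using x by (auto simp: finite_energy_def)
  then have "(\<Sum>k. ereal (cost x k)) = \<infinity>"
    using suminf_ereal_eq_PInfty[OF summable_divide[OF summable_w], of \<beta> "cost x"] cost_ge[of x] x0 by blast
  then have "rate_I d \<beta> \<alpha> x = \<infinity>" by (simp add: rate_I_def cost_def)
  then show ?thesis by (simp add: F_def)
qed (simp add: F_def)

lemma total_density_\<xi>: "0 \<le> s \<Longrightarrow> total_density (\<xi> s) = ereal (N s)"
  using suminf_ereal'[OF \<xi>_summable[of s]] by (simp add: total_density_def D_\<xi>[symmetric] D_def)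

section \<open>The slope condition\<close>

lemma T_has_derivative:
  assumes "0 < s"
  shows "((\<lambda>s. T s k / real (Suc k)) has_field_derivative - \<beta> * (T s k / (1 - T s k))) (at s)" and "T s k < 1"
proof -
  have lt: "z s k < exp (- 1)" using z_less[OF assms, of k] z_0_le[of k] by simp
  show T1: "T s k < 1" unfolding T_def using tree_deriv(2)[OF z_pos lt] .
  define n where "n = real (Suc k)"
  have n: "0 < n" by (simp add: n_def)
  have "((\<lambda>s. z s k) has_field_derivative - \<beta> * n * z s k) (at s)"
    unfolding z_def n_def[symmetric] by (auto intro!: derivative_eq_intros)
  from DERIV_chain2[OF tree_deriv(1)[OF z_pos lt] this]
  have "((\<lambda>s. T s k / n) has_field_derivative (T s k / (z s k * (1 - T s k)) * (- \<beta> * n * z s k)) / n) (at s)"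
    unfolding T_def by (rule DERIV_cdivide)
  moreover have "(T s k / (z s k * (1 - T s k)) * (- \<beta> * n * z s k)) / n = - \<beta> * (T s k / (1 - T s k))"
    using T1 n z_pos[of s k] by (simp add: divide_simps)
  ultimately show "((\<lambda>s. T s k / real (Suc k)) has_field_derivative - \<beta> * (T s k / (1 - T s k))) (at s)"
    by (simp only: n_def)
qed

text \<open>
  The differentiated series is dominated on \<open>[s / 2, \<infinity>)\<close> by a geometric one: there the arguments of
  the tree function stay below \<open>\<rho> exp (- 1)\<close> with \<open>\<rho> < 1\<close>, away from the branch point. This is needed
  because \<open>deriv\<close> carries information only at points of differentiability.
\<close>

lemma N_differentiable:
  assumes s: "0 < s" shows "N differentiable (at s)"
proof -
  define r where "r = s / 2"
  define \<rho> where "\<rho> = exp (- (\<beta> * r))"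
  define \<tau> where "\<tau> = tree (exp (- 1) * \<rho>)"
  have r: "0 < r" using s by (simp add: r_def)
  have \<rho>: "0 < \<rho>" "\<rho> < 1" using r \<beta> by (auto simp: \<rho>_def)
  have \<tau>: "\<tau> < 1" unfolding \<tau>_def by (rule tree_deriv(2)) (use \<rho> in auto)
  have zb: "z x k \<le> exp (- 1) * \<rho> ^ Suc k" if "r \<le> x" for x k
  proof -
    have "z x k \<le> z r k" using that by (rule z_antimono)
    also have "\<dots> = (b * \<beta> * (real (Suc k))\<^sup>2 * w k) * \<rho> ^ Suc k"
      unfolding z_def \<rho>_def exp_of_nat_mult[symmetric] by (simp add: mult_ac)
    also have "\<dots> \<le> exp (- 1) * \<rho> ^ Suc k"
      using weight_le[of k] \<rho> by (intro mult_right_mono) auto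
    finally show ?thesis .
  qed
  have pow_le: "\<rho> ^ Suc k \<le> \<rho>" for k using \<rho> power_decreasing[of 1 "Suc k" \<rho>] by simp
  have bound: "norm (- \<beta> * (T x k / (1 - T x k))) \<le> \<beta> / (1 - \<tau>) * \<rho> ^ Suc k" if x: "x \<in> {r..}" for x k
  proof -
    have x0: "0 \<le> x" using x r by simp
    have "z x k \<le> exp (- 1) * \<rho>" using zb[of x k] x pow_le[of k] by (smt (verit) atLeast_iff exp_gt_zero mult_left_mono)
    moreover have "exp (- 1) * \<rho> \<le> exp (- 1)" using \<rho> by simp
    ultimately have T\<tau>: "T x k \<le> \<tau>"
      using tree_less[of "z x k" "exp (- 1) * \<rho>"] z_pos[of x k]
      by (cases "z x k = exp (- 1) * \<rho>") (auto simp: T_def \<tau>_def)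
    have "T x k \<le> exp 1 * z x k" unfolding T_def using z_pos[of x k] z_le[OF x0] by (intro tree_le) auto
    also have "\<dots> \<le> exp 1 * (exp (- 1) * \<rho> ^ Suc k)" using zb[of x k] x by (intro mult_left_mono) auto
    also have "\<dots> = \<rho> ^ Suc k" by (simp add: exp_minus)
    finally have "T x k / (1 - T x k) \<le> \<rho> ^ Suc k / (1 - \<tau>)"
      using T\<tau> \<tau> T_pos[OF x0, of k] \<rho> by (intro frac_le) auto
    then have "\<beta> * (T x k / (1 - T x k)) \<le> \<beta> * (\<rho> ^ Suc k / (1 - \<tau>))" using \<beta> by (intro mult_left_mono) auto
    moreover have "norm (- \<beta> * (T x k / (1 - T x k))) = \<beta> * (T x k / (1 - T x k))"
    proof -
      have "\<bar>- \<beta> * u\<bar> = \<beta> * u" if "0 \<le> u" for u using that \<beta> by (simp add: abs_mult)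
      moreover have "0 \<le> T x k / (1 - T x k)" using T_pos[OF x0, of k] T\<tau> \<tau> by simp
      ultimately show ?thesis unfolding real_norm_def by blast
    qed
    moreover have "\<beta> * (\<rho> ^ Suc k / (1 - \<tau>)) = \<beta> / (1 - \<tau>) * \<rho> ^ Suc k" by simp
    ultimately show ?thesis by (simp only:)
  qed
  have summ: "summable (\<lambda>k. \<beta> / (1 - \<tau>) * \<rho> ^ Suc k)"
    using \<rho> by (intro summable_mult) (simp add: summable_mult summable_geometric)
  have "((\<lambda>x. \<Sum>k. T x k / real (Suc k)) has_field_derivative (\<Sum>k. - \<beta> * (T s k / (1 - T s k)))) (at s)"
  proof (rule has_field_derivative_series'(2))
    show "convex {r..}" by simp
    show "((\<lambda>x. T x k / real (Suc k)) has_field_derivative - \<beta> * (T x k / (1 - T x k))) (at x within {r..})"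
      if "x \<in> {r..}" for x k
      by (rule has_field_derivative_at_within[OF T_has_derivative(1)]) (use that r in simp)
    show "uniformly_convergent_on {r..} (\<lambda>n x. \<Sum>i<n. - \<beta> * (T x i / (1 - T x i)))"
      unfolding uniformly_convergent_on_def
      by (rule exI, rule Weierstrass_m_test[OF _ summ]) (rule bound)
    show "s \<in> {r..}" "s \<in> interior {r..}" using s by (auto simp: r_def interior_real_atLeast)
    show "summable (\<lambda>k. T s k / real (Suc k))" using s by (intro summable_T) simp
  qed
  then have "(N has_field_derivative 1 / (b * \<beta>) * (\<Sum>k. - \<beta> * (T s k / (1 - T s k)))) (at s)"
    unfolding N_def by (rule DERIV_cmult)
  then show ?thesis by (auto simp: real_differentiable_def)
qed

text \<open>
  The mean value theorem on a short interval ending at \<open>0\<close>, where the derivative of \<open>h_tilde\<close> exceeds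
  \<open>1\<close>, translated by \<open>s = - c x\<close>.
\<close>

lemma steep_of_left_slope:
  assumes "left_slope_gt_one (h_tilde d \<beta> \<alpha> a b) 0"
  shows "\<exists>s>0. a * N s + (a - b) / b * s < a * N 0"
proof -
  define h where "h = h_tilde d \<beta> \<alpha> a b"
  define c where "c = a * b / (a - b)"
  have c: "0 < c" using b b_less_a by (simp add: c_def)
  have h: "h x = N (- c * x)" if "x \<le> 0" for x using h_tilde_eq[OF that] by (simp add: h_def c_def)
  obtain l :: ereal where "((\<lambda>x. ereal (deriv h x)) \<longlongrightarrow> l) (at_left 0)" "1 < l"
    using assms by (auto simp: left_slope_gt_one_def h_def)
  then have "\<forall>\<^sub>F x in at_left 0. 1 < ereal (deriv h x)" by (rule order_tendstoD(1))
  then obtain x0 where x0: "x0 < 0" "\<And>x. x0 < x \<Longrightarrow> x < 0 \<Longrightarrow> 1 < deriv h x"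
    by (auto simp: eventually_at_left_field)
  have "\<exists>l z. x0 < z \<and> z < 0 \<and> DERIV h z :> l \<and> h 0 - h x0 = (0 - x0) * l"
  proof (rule MVT[OF x0(1)])
    have "continuous_on {x0..0} (\<lambda>x. N (- c * x))"
      by (rule continuous_on_compose2[OF N_cont]) (use c in \<open>auto intro!: continuous_intros mult_nonneg_nonpos\<close>)
    then show "continuous_on {x0..0} h" by (rule continuous_on_eq) (simp add: h)
    show "h differentiable (at x)" if "x0 < x" "x < 0" for x
    proof -
      have "0 < - c * x" using c that by (simp add: mult_pos_neg)
      then obtain D where "DERIV N (- c * x) :> D"
        using N_differentiable[of "- c * x"] unfolding real_differentiable_def by blast
      then have "DERIV (\<lambda>x. N (- c * x)) x :> D * (- c)"
        by (rule DERIV_chain2) (auto intro!: derivative_eq_intros)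
      then have "DERIV h x :> D * (- c)"
        by (rule has_field_derivative_transform_within_open[of _ _ _ "{..<0}"]) (use that in \<open>auto simp: h\<close>)
      then show ?thesis by (auto simp: real_differentiable_def)
    qed
  qed
  then obtain l y where y: "x0 < y" "y < 0" "DERIV h y :> l" "h 0 - h x0 = - x0 * l" by auto
  then have "1 < l" using x0(2)[of y] DERIV_imp_deriv by blast
  then have "- x0 * 1 < - x0 * l" using x0(1) by (intro mult_strict_left_mono) auto
  then have less: "N (- c * x0) - x0 < N 0" using y(4) h[of 0] h[of x0] x0(1) by (simp only: mult_zero_right)
  define s where "s = - c * x0"
  have "(a - b) / b * s = a * (- x0)" using b b_less_a by (simp add: s_def c_def)
  then have "a * N s + (a - b) / b * s = a * (N (- c * x0) - x0)" by (simp add: s_def algebra_simps)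
  also have "\<dots> < a * N 0" using less b b_less_a by (intro mult_strict_left_mono) auto
  finally have "a * N s + (a - b) / b * s < a * N 0" .
  moreover have "0 < s" using c x0(1) by (simp add: s_def mult_pos_neg)
  ultimately show ?thesis by blast
qed

text \<open>
  Here \<open>N\<close> descends from \<open>N 0\<close> with infinite slope: the slope is at least \<open>\<beta> \<Sum> k\<^sup>2 q\<^sub>k\<close>, whose
  terms are at least of the order \<open>1 / k\<close>. Finitely many terms already suffice for the required difference quotient.
\<close>

lemma steep_of_low_dimension:
  assumes "d \<le> 4" "\<alpha> = 0"
  shows "\<exists>s>0. a * N s + (a - b) / b * s < a * N 0"
proof -
  define v where "v k = (real (Suc k))\<^sup>2 * w k" for k
  have v: "0 \<le> v k" for k using w_pos[of k] by (simp add: v_def)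
  have "\<not> summable v"
  proof
    assume "summable v"
    moreover have "norm (C * inverse (real (Suc k))) \<le> v k" for k
    proof -
      have "real (Suc k) powr (- 1) \<le> real (Suc k) powr (real 2 - 1 - real d / 2)"
        using assms by (intro powr_mono) auto
      then have "C * real (Suc k) powr (- 1) \<le> v k"
        using mult_left_mono[of "real (Suc k) powr (- 1)" _ C] assms(2) C_pos
        unfolding v_def power_w by simp
      then show ?thesis using C_pos by (simp add: powr_minus)
    qed
    ultimately have "summable (\<lambda>k. C * inverse (real (Suc k)))" by (rule summable_comparison_test'[of v 0])
    then have "summable (\<lambda>k. inverse (real (Suc k)))" using C_pos by (simp add: summable_cmult_iff)
    then have "summable (\<lambda>k. inverse (real k))"
      by (rule summable_Suc_iff[of "\<lambda>k. inverse (real k)", THEN iffD1])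
    then show False using not_summable_harmonic[where 'a = real] by (simp add: inverse_eq_divide)
  qed
  \<comment> \<open>The bound that the partial sum has to exceed to beat \<open>1 / c\<close>; one factor \<open>2\<close> is lost in
      \<open>1 - exp (- x) \<ge> x / 2\<close>, which holds on \<open>[0, 1]\<close>.\<close>
  define M where "M = 2 * (a - b) / (a * b * \<beta>)"
  obtain K where K: "M < sum v {..<K}"
    using summableI_nonneg_bounded[of v M] v \<open>\<not> summable v\<close> by (meson not_le)
  have "0 < K" using K b b_less_a \<beta> by (cases K) (auto simp: M_def divide_less_0_iff mult_less_0_iff zero_less_mult_iff)
  \<comment> \<open>This keeps the exponents \<open>\<beta> n s\<close> of the first \<open>K\<close> terms in \<open>[0, 1]\<close>.\<close>
  define s where "s = 1 / (\<beta> * real K)"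
  have s: "0 < s" using \<open>0 < K\<close> \<beta> by (simp add: s_def)
  have summand: "b * \<beta> * (\<beta> * s / 2) * v k \<le> T 0 k / real (Suc k) - T s k / real (Suc k)" if "k < K" for k
  proof -
    define n where "n = real (Suc k)"
    define x where "x = \<beta> * n * s"
    have n: "0 < n" "n \<le> real K" using that by (auto simp: n_def)
    have x: "0 < x" "x \<le> 1" using n \<open>0 < K\<close> \<beta> by (auto simp: x_def s_def)
    have "exp (- x) \<le> 1 - x / 2"
    proof -
      have "1 + x \<le> exp x" using exp_ge_add_one_self by blast
      then have "exp (- x) \<le> 1 / (1 + x)" using x by (simp add: exp_minus field_simps)
      also have "\<dots> \<le> 1 - x / 2"
      proof -
        have "x * x \<le> 1 * x" using x by (intro mult_right_mono) auto
        then show ?thesis using x by (simp add: field_simps)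
      qed
      finally show ?thesis .
    qed
    then have "z 0 k * (x / 2) \<le> z 0 k * (1 - exp (- x))" using z_pos[of 0 k] by (intro mult_left_mono) auto
    also have "\<dots> = z 0 k - z s k" by (simp add: z_def x_def n_def algebra_simps)
    also have "\<dots> \<le> T 0 k - T s k"
      unfolding T_def using z_pos[of s k] z_antimono[of 0 s k] z_0_le[of k] s by (intro tree_diff_ge) auto
    finally have "z 0 k * (x / 2) / n \<le> (T 0 k - T s k) / n" using n by (intro divide_right_mono) auto
    moreover have "z 0 k * (x / 2) / n = b * \<beta> * (\<beta> * s / 2) * v k"
      unfolding z_def x_def v_def n_def[symmetric] using n by simp
    ultimately show ?thesis unfolding n_def[symmetric] diff_divide_distrib[symmetric] by (simp only:)
  qed
  have sm: "summable (\<lambda>k. T 0 k / real (Suc k) - T s k / real (Suc k))"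
    using s by (intro summable_diff summable_T) auto
  have "b * \<beta> * (\<beta> * s / 2) * sum v {..<K} = (\<Sum>k<K. b * \<beta> * (\<beta> * s / 2) * v k)" by (rule sum_distrib_left)
  also have "\<dots> \<le> (\<Sum>k<K. T 0 k / real (Suc k) - T s k / real (Suc k))" using summand by (intro sum_mono) auto
  also have "\<dots> \<le> (\<Sum>k. T 0 k / real (Suc k) - T s k / real (Suc k))"
  proof (rule sum_le_suminf[OF sm])
    show "0 \<le> T 0 k / real (Suc k) - T s k / real (Suc k)" for k
      using divide_right_mono[OF less_imp_le[OF T_less[of 0 s k]], of "real (Suc k)"] s by simp
  qed simp
  also have "\<dots> = b * \<beta> * (N 0 - N s)"
    unfolding N_def using suminf_diff[OF summable_T[of 0] summable_T[of s]] s b \<beta> by (simp add: field_simps)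
  finally have "\<beta> * s / 2 * sum v {..<K} \<le> N 0 - N s" using b \<beta> by (simp add: mult.assoc)
  moreover have "\<beta> * s / 2 * M < \<beta> * s / 2 * sum v {..<K}" using K \<beta> s by (intro mult_strict_left_mono) auto
  ultimately have "a * (\<beta> * s / 2 * M) < a * (N 0 - N s)" using b b_less_a by (intro mult_strict_left_mono) auto
  moreover have "a * (\<beta> * s / 2 * M) = (a - b) / b * s" using b b_less_a \<beta> by (simp add: M_def field_simps)
  ultimately have "(a - b) / b * s < a * (N 0 - N s)" by (simp only:)
  then have "a * N s + (a - b) / b * s < a * N 0" unfolding right_diff_distrib by linarith
  then show ?thesis using s by blast
qed

end

lemma g0_eq_h_tilde:
  assumes "a > 0" "\<delta> < \<mu> / a"
  shows "g0 d \<beta> \<alpha> a b \<mu> \<delta> = h_tilde d \<beta> \<alpha> a b (\<delta> - \<mu> / a)"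
proof -
  have "\<not> \<mu> \<le> a * \<delta>" using assms by (simp add: field_simps)
  then have "E \<beta> a b \<mu> k \<delta> = a * b / (a - b) * \<beta> * real k * (\<delta> - \<mu> / a)" for k
  proof -
    have "\<mu> - a * \<delta> = - a * (\<delta> - \<mu> / a)" using assms by (simp add: algebra_simps)
    then show ?thesis using \<open>\<not> \<mu> \<le> a * \<delta>\<close> by (simp add: E_def)
  qed
  then show ?thesis unfolding g0_def h_tilde_def by simp
qed

text \<open>
  The derivatives agree point by point, even where they do not exist, since \<open>deriv\<close> depends only on the
  set of admissible slopes.
\<close>

lemma left_slope_shift:
  assumes "\<And>x. x < c \<Longrightarrow> g x = h (x - c)"
  shows "left_slope_gt_one h 0 \<longleftrightarrow> left_slope_gt_one g c"
proof -
  have "deriv g x = deriv h (x - c)" if "x < c" for x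
  proof -
    have "DERIV g x :> D \<longleftrightarrow> DERIV h (x - c) :> D" for D
    proof -
      have "DERIV g x :> D \<longleftrightarrow> DERIV (\<lambda>x. h (x - c)) x :> D"
        using that assms by (intro DERIV_cong_ev refl eventually_mono[OF eventually_nhds_in_open[of "{..<c}" x]]) auto
      then show ?thesis using DERIV_shift[of h D x "- c"] by simp
    qed
    then show ?thesis by (simp add: deriv_def)
  qed
  then have "((\<lambda>x. ereal (deriv g x)) \<longlongrightarrow> l) (at_left c) \<longleftrightarrow> ((\<lambda>x. ereal (deriv h (x - c))) \<longlongrightarrow> l) (at_left c)" for l
    by (intro tendsto_cong) (simp add: eventually_at_filter)
  moreover have "((\<lambda>x. ereal (deriv h (x - c))) \<longlongrightarrow> l) (at_left c) \<longleftrightarrow> ((\<lambda>x. ereal (deriv h x)) \<longlongrightarrow> l) (at_left 0)" for l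
    unfolding filterlim_at_left_to_right[of _ _ c] filterlim_at_left_to_right[of _ _ 0]
      filterlim_at_right_to_0[of _ _ "- c"] by simp
  ultimately show ?thesis by (simp add: left_slope_gt_one_def)
qed

section \<open>The phase transition\<close>

lemma minimisers_eqI:
  assumes "A \<subseteq> l1_plus" "A \<noteq> {}" "\<And>x. x \<in> A \<Longrightarrow> F d \<beta> \<alpha> a b \<mu> x = m"
    and "\<And>x. x \<in> l1_plus \<Longrightarrow> m < F d \<beta> \<alpha> a b \<mu> x \<or> x \<in> A"
  shows "minimisers d \<beta> \<alpha> a b \<mu> = A" "(INF x\<in>l1_plus. F d \<beta> \<alpha> a b \<mu> x) = m"
proof -
  have le: "m \<le> F d \<beta> \<alpha> a b \<mu> x" if "x \<in> l1_plus" for x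
    using assms(3,4) that by force
  obtain x0 where x0: "x0 \<in> A" using assms(2) by blast
  show "minimisers d \<beta> \<alpha> a b \<mu> = A"
    unfolding minimisers_def is_arg_min_def
  proof (safe)
    fix x assume x: "x \<in> l1_plus" "\<nexists>y. y \<in> l1_plus \<and> F d \<beta> \<alpha> a b \<mu> y < F d \<beta> \<alpha> a b \<mu> x"
    then have "\<not> m < F d \<beta> \<alpha> a b \<mu> x" using x0 assms(1,3) by auto
    then show "x \<in> A" using assms(4) x(1) by blast
  next
    fix x y assume "x \<in> A" "y \<in> l1_plus" "F d \<beta> \<alpha> a b \<mu> y < F d \<beta> \<alpha> a b \<mu> x"
    then show False using le[of y] assms(3)[of x] by simp
  qed (use assms(1) in auto)
  show "(INF x\<in>l1_plus. F d \<beta> \<alpha> a b \<mu> x) = m"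
  proof (rule antisym)
    show "(INF x\<in>l1_plus. F d \<beta> \<alpha> a b \<mu> x) \<le> m"
      using INF_lower[of x0 l1_plus "F d \<beta> \<alpha> a b \<mu>"] x0 assms(1,3) by auto
    show "m \<le> (INF x\<in>l1_plus. F d \<beta> \<alpha> a b \<mu> x)" by (rule INF_greatest) (rule le)
  qed
qed

locale hyl_transition = hyl_gas +
  assumes steep: "\<exists>s>0. a * N s + (a - b) / b * s < a * N 0"
begin

sublocale curve: density_curve a b N \<Psi>
  by unfold_locales (use b b_less_a N_cont N_nonneg N_less N_strictly_convex \<Psi>_supergradient steep in auto)

abbreviation "\<xi>_R \<mu> \<equiv> \<xi> (curve.s_R \<mu>)"
abbreviation "\<xi>_L \<mu> \<equiv> \<xi> (curve.s_L \<mu>)"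

lemma mu_p_eq: "mu_p d \<beta> \<alpha> a b = a * N 0"
  by (simp add: mu_p_def h_tilde_eq)

text \<open>
  Under \<open>x = - s / c\<close> the function \<open>a (h_tilde x - x)\<close> becomes \<open>L s\<close>.
\<close>

lemma mu_tang_eq: "mu_tang d \<beta> \<alpha> a b = curve.L curve.s_tang"
proof -
  define c where "c = a * b / (a - b)"
  have c: "0 < c" using b b_less_a by (simp add: c_def)
  have h: "h_tilde d \<beta> \<alpha> a b x - x = curve.L (- c * x) / a" if "x \<le> 0" for x
  proof -
    have "(a - b) / b * (- c * x) = - a * x" using b b_less_a by (simp add: c_def)
    then show ?thesis unfolding curve.L_def using h_tilde_eq[OF that] b b_less_a by (simp add: c_def field_simps)
  qed
  have nonneg: "0 \<le> - c * x" if "x \<le> 0" for x using that c by (simp add: mult_nonneg_nonpos)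
  have "(INF x\<in>{..0}. h_tilde d \<beta> \<alpha> a b x - x) = curve.L curve.s_tang / a"
  proof (rule cInf_eq_minimum)
    show "curve.L curve.s_tang / a \<in> (\<lambda>x. h_tilde d \<beta> \<alpha> a b x - x) ` {..0}"
    proof (rule image_eqI)
      have "- curve.s_tang / c \<le> 0" using curve.s_tang_nonneg c by simp
      then show "curve.L curve.s_tang / a = h_tilde d \<beta> \<alpha> a b (- curve.s_tang / c) - (- curve.s_tang / c)"
        using h[of "- curve.s_tang / c"] c by simp
      show "- curve.s_tang / c \<in> {..0}" using curve.s_tang_nonneg c by simp
    qed
    show "curve.L curve.s_tang / a \<le> y" if "y \<in> (\<lambda>x. h_tilde d \<beta> \<alpha> a b x - x) ` {..0}" for y
      using that h nonneg curve.L_s_tang_le curve.a_pos by (auto intro!: divide_right_mono)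
  qed
  then show ?thesis using curve.a_pos by (simp add: mu_tang_def)
qed

lemma L_tang_less: "curve.L curve.s_tang < a * N 0"
  using curve.L_s_tang_less by (simp add: curve.L_0)

lemma s_R_nonneg: "\<mu> \<le> a * N 0 \<Longrightarrow> 0 \<le> curve.s_R \<mu>"
  using curve.s_R_nonneg[of \<mu>] by (simp add: curve.R_0)

lemma s_L_nonneg: "curve.L curve.s_tang \<le> \<mu> \<Longrightarrow> 0 \<le> curve.s_L \<mu>"
  using curve.s_L_gt_0[of \<mu>] by simp

lemma F_\<xi>: "0 \<le> s \<Longrightarrow> F d \<beta> \<alpha> a b \<mu> (\<xi> s) = ereal (\<Psi> s - s * N s + mean_field a b \<mu> (N s))"
  using F_finite[OF \<xi>_finite_energy, of s \<mu>] e_\<xi>[of s] D_\<xi>[of s] by simp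

lemma F_\<xi>_R: "\<mu> \<le> a * N 0 \<Longrightarrow> F d \<beta> \<alpha> a b \<mu> (\<xi>_R \<mu>) = ereal (curve.P_R \<mu>)"
  using F_\<xi>[OF s_R_nonneg] curve.P_R_attained[of \<mu>] by simp

lemma F_\<xi>_L: "curve.L curve.s_tang \<le> \<mu> \<Longrightarrow> F d \<beta> \<alpha> a b \<mu> (\<xi>_L \<mu>) = ereal (curve.P_L \<mu>)"
  using F_\<xi>[OF s_L_nonneg] curve.P_L_attained[of \<mu>] by simp

lemma \<xi>_l1: "0 \<le> s \<Longrightarrow> \<xi> s \<in> l1_plus"
  using \<xi>_finite_energy[of s] by (simp add: finite_energy_def)

text \<open>
  A sequence outside the box is compared through its truncation, which has strictly smaller energy; so
  equality forces the sequence into the box and then onto a candidate.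
\<close>

lemma F_two_wells:
  assumes "x \<in> l1_plus"
  shows "\<mu> \<le> a * N 0 \<and> (ereal (curve.P_R \<mu>) < F d \<beta> \<alpha> a b \<mu> x \<or> x = \<xi>_R \<mu>)
     \<or> curve.L curve.s_tang \<le> \<mu> \<and> (ereal (curve.P_L \<mu>) < F d \<beta> \<alpha> a b \<mu> x \<or> x = \<xi>_L \<mu>)"
proof (cases "finite_energy x")
  case False
  then show ?thesis using F_infinite[OF assms False, of \<mu>] L_tang_less by auto
next
  case fin: True
  have tr: "finite_energy (trunc x)" "box (trunc x)" using trunc_improves(1)[OF fin] trunc_box by auto
  note wells = curve.two_well_bound[where e = "e y" and \<delta> = "D y" and \<mu> = \<mu> for y]
  show ?thesis
  proof (cases "box x")
    case True
    then show ?thesis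
      using wells[of x, OF e_ge_\<Psi>(1)[OF _ fin True]] e_ge_\<Psi>(2)[OF _ fin True]
        s_R_nonneg[of \<mu>] s_L_nonneg[of \<mu>] by (auto simp: F_finite[OF fin])
  next
    case False
    then show ?thesis
      using wells[of "trunc x", OF e_ge_\<Psi>(1)[OF _ tr]] trunc_improves(3)[OF fin False, of \<mu>]
      by (auto simp: F_finite[OF fin])
  qed
qed

text \<open>
  The upper bounds are the energies of the candidates, the lower bounds are those of \<open>F_two_wells\<close>; the sign
  of \<open>P_R - P_L\<close> decides which candidate wins.
\<close>

theorem transition:
  obtains \<nu> where "curve.L curve.s_tang < \<nu>" "\<nu> < a * N 0" "curve.P_R \<nu> = curve.P_L \<nu>"
    "\<And>\<mu>. \<mu> < \<nu> \<Longrightarrow> minimisers d \<beta> \<alpha> a b \<mu> = {\<xi>_R \<mu>}"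
    "\<And>\<mu>. \<nu> < \<mu> \<Longrightarrow> minimisers d \<beta> \<alpha> a b \<mu> = {\<xi>_L \<mu>}"
    "minimisers d \<beta> \<alpha> a b \<nu> = {\<xi>_R \<nu>, \<xi>_L \<nu>}"
    "\<And>\<mu>. (INF x\<in>l1_plus. F d \<beta> \<alpha> a b \<mu> x) = ereal (curve.P \<nu> \<mu>)"
proof -
  obtain \<nu> where \<nu>: "curve.L curve.s_tang < \<nu>" "\<nu> < a * N 0" "curve.P_R \<nu> = curve.P_L \<nu>"
    "\<And>\<mu>. curve.L curve.s_tang \<le> \<mu> \<Longrightarrow> \<mu> < \<nu> \<Longrightarrow> curve.P_R \<mu> < curve.P_L \<mu>"
    "\<And>\<mu>. \<nu> < \<mu> \<Longrightarrow> \<mu> \<le> a * N 0 \<Longrightarrow> curve.P_L \<mu> < curve.P_R \<mu>"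
    using curve.crossing_exists by blast
  have below: "minimisers d \<beta> \<alpha> a b \<mu> = {\<xi>_R \<mu>}" "(INF x\<in>l1_plus. F d \<beta> \<alpha> a b \<mu> x) = ereal (curve.P_R \<mu>)"
    if "\<mu> < \<nu>" for \<mu>
  proof -
    have mu: "\<mu> \<le> a * N 0" using that \<nu>(2) by simp
    have bound: "ereal (curve.P_R \<mu>) < F d \<beta> \<alpha> a b \<mu> x \<or> x \<in> {\<xi>_R \<mu>}" if x: "x \<in> l1_plus" for x
    proof -
      have "ereal (curve.P_R \<mu>) < F d \<beta> \<alpha> a b \<mu> x"
        if "curve.L curve.s_tang \<le> \<mu>" "ereal (curve.P_L \<mu>) < F d \<beta> \<alpha> a b \<mu> x \<or> x = \<xi>_L \<mu>"
        using \<nu>(4)[OF that(1) \<open>\<mu> < \<nu>\<close>] that F_\<xi>_L[OF that(1)] by (auto intro: less_trans[of _ "ereal (curve.P_L \<mu>)"])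
      then show ?thesis using F_two_wells[OF x, of \<mu>] by blast
    qed
    show "minimisers d \<beta> \<alpha> a b \<mu> = {\<xi>_R \<mu>}" "(INF x\<in>l1_plus. F d \<beta> \<alpha> a b \<mu> x) = ereal (curve.P_R \<mu>)"
      by (rule minimisers_eqI[where m = "ereal (curve.P_R \<mu>)" and A = "{\<xi>_R \<mu>}"];
          use bound F_\<xi>_R[OF mu] \<xi>_l1[OF s_R_nonneg[OF mu]] in auto)+
  qed
  have above: "minimisers d \<beta> \<alpha> a b \<mu> = {\<xi>_L \<mu>}" "(INF x\<in>l1_plus. F d \<beta> \<alpha> a b \<mu> x) = ereal (curve.P_L \<mu>)"
    if "\<nu> < \<mu>" for \<mu>
  proof -
    have mu: "curve.L curve.s_tang \<le> \<mu>" using that \<nu>(1) by simp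
    have bound: "ereal (curve.P_L \<mu>) < F d \<beta> \<alpha> a b \<mu> x \<or> x \<in> {\<xi>_L \<mu>}" if x: "x \<in> l1_plus" for x
    proof -
      have "ereal (curve.P_L \<mu>) < F d \<beta> \<alpha> a b \<mu> x"
        if "\<mu> \<le> a * N 0" "ereal (curve.P_R \<mu>) < F d \<beta> \<alpha> a b \<mu> x \<or> x = \<xi>_R \<mu>"
        using \<nu>(5)[OF \<open>\<nu> < \<mu>\<close> that(1)] that F_\<xi>_R[OF that(1)] by (auto intro: less_trans[of _ "ereal (curve.P_R \<mu>)"])
      then show ?thesis using F_two_wells[OF x, of \<mu>] by blast
    qed
    show "minimisers d \<beta> \<alpha> a b \<mu> = {\<xi>_L \<mu>}" "(INF x\<in>l1_plus. F d \<beta> \<alpha> a b \<mu> x) = ereal (curve.P_L \<mu>)"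
      by (rule minimisers_eqI[where m = "ereal (curve.P_L \<mu>)" and A = "{\<xi>_L \<mu>}"];
          use bound F_\<xi>_L[OF mu] \<xi>_l1[OF s_L_nonneg[OF mu]] in auto)+
  qed
  have at: "minimisers d \<beta> \<alpha> a b \<nu> = {\<xi>_R \<nu>, \<xi>_L \<nu>}" "(INF x\<in>l1_plus. F d \<beta> \<alpha> a b \<nu> x) = ereal (curve.P_R \<nu>)"
    using F_two_wells[of _ \<nu>] \<nu>(1-3) F_\<xi>_L[of \<nu>] F_\<xi>_R[of \<nu>] \<xi>_l1[OF s_L_nonneg[of \<nu>]] \<xi>_l1[OF s_R_nonneg[of \<nu>]]
    by (intro minimisers_eqI[where m = "ereal (curve.P_R \<nu>)" and A = "{\<xi>_R \<nu>, \<xi>_L \<nu>}"]; auto)+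
  show thesis
  proof (rule that[OF \<nu>(1-3) below(1) above(1) at(1)])
    show "(INF x\<in>l1_plus. F d \<beta> \<alpha> a b \<mu> x) = ereal (curve.P \<nu> \<mu>)" for \<mu>
      using below(2)[of \<mu>] above(2)[of \<mu>] at(2) by (cases \<mu> \<nu> rule: linorder_cases) (auto simp: curve.P_def)
  qed auto
qed

lemma transition_densities:
  assumes "curve.L curve.s_tang < \<nu>" "\<nu> < a * N 0"
  shows "ereal (\<nu> / a) < total_density (\<xi>_R \<nu>)" "total_density (\<xi>_L \<nu>) < ereal (\<nu> / a)"
proof -
  have sR: "0 < curve.s_R \<nu>" and sL: "0 < curve.s_L \<nu>"
    using curve.s_R_gt_0 curve.s_L_gt_0 assms by auto
  show "ereal (\<nu> / a) < total_density (\<xi>_R \<nu>)"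
    using total_density_\<xi>[of "curve.s_R \<nu>"] sR curve.N_s_R[of \<nu>] assms curve.a_pos by (simp add: divide_strict_right_mono)
  have "0 < (a - b) / (a * b) * curve.s_L \<nu>" using sL b b_less_a by simp
  then show "total_density (\<xi>_L \<nu>) < ereal (\<nu> / a)"
    using total_density_\<xi>[of "curve.s_L \<nu>"] sL curve.N_s_L[of \<nu>] assms by simp
qed

theorem unique_transition:
  "(\<exists>!\<mu>s. \<mu>s \<in> {mu_tang d \<beta> \<alpha> a b<..<mu_p d \<beta> \<alpha> a b} \<and> single_transition_at d \<beta> \<alpha> a b \<mu>s) \<and>
   (\<forall>\<mu>s \<in> {mu_tang d \<beta> \<alpha> a b<..<mu_p d \<beta> \<alpha> a b}.
      single_transition_at d \<beta> \<alpha> a b \<mu>s \<longrightarrow>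
        (\<exists>\<phi>::real \<Rightarrow> real.
           (\<forall>\<mu>. ereal (\<phi> \<mu>) = (INF x\<in>l1_plus. F d \<beta> \<alpha> a b \<mu> x)) \<and>
           \<phi> differentiable_on ({..<\<mu>s} \<union> {\<mu>s<..}) \<and>
           (\<forall>U. open U \<and> \<mu>s \<in> U \<longrightarrow> \<not> \<phi> differentiable_on U)) \<and>
        (\<exists>\<xi>1 \<xi>2. minimisers d \<beta> \<alpha> a b \<mu>s = {\<xi>1, \<xi>2} \<and>
           total_density \<xi>1 > ereal (\<mu>s / a) \<and> ereal (\<mu>s / a) > total_density \<xi>2))"
proof -
  obtain \<nu> where \<nu>: "curve.L curve.s_tang < \<nu>" "\<nu> < a * N 0" "curve.P_R \<nu> = curve.P_L \<nu>"
    "\<And>\<mu>. \<mu> < \<nu> \<Longrightarrow> minimisers d \<beta> \<alpha> a b \<mu> = {\<xi>_R \<mu>}"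
    "\<And>\<mu>. \<nu> < \<mu> \<Longrightarrow> minimisers d \<beta> \<alpha> a b \<mu> = {\<xi>_L \<mu>}"
    "minimisers d \<beta> \<alpha> a b \<nu> = {\<xi>_R \<nu>, \<xi>_L \<nu>}"
    "\<And>\<mu>. (INF x\<in>l1_plus. F d \<beta> \<alpha> a b \<mu> x) = ereal (curve.P \<nu> \<mu>)"
    using transition by blast
  note dens = transition_densities[OF \<nu>(1,2)]
  have "\<xi>_R \<nu> \<noteq> \<xi>_L \<nu>" using dens by auto
  then have st: "single_transition_at d \<beta> \<alpha> a b \<nu>"
    unfolding single_transition_at_def using \<nu>(4-6) by auto
  have unique: "\<mu> = \<nu>" if "single_transition_at d \<beta> \<alpha> a b \<mu>" for \<mu>
  proof (rule ccontr)
    assume "\<mu> \<noteq> \<nu>"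
    then have "card (minimisers d \<beta> \<alpha> a b \<mu>) = 1" using \<nu>(4,5)[of \<mu>] by (cases "\<mu> < \<nu>") auto
    then show False using that by (simp add: single_transition_at_def)
  qed
  have pressure: "\<exists>\<phi>::real \<Rightarrow> real. (\<forall>\<mu>. ereal (\<phi> \<mu>) = (INF x\<in>l1_plus. F d \<beta> \<alpha> a b \<mu> x)) \<and>
      \<phi> differentiable_on ({..<\<nu>} \<union> {\<nu><..}) \<and> (\<forall>U. open U \<and> \<nu> \<in> U \<longrightarrow> \<not> \<phi> differentiable_on U)"
    using \<nu>(7) curve.P_differentiable[OF \<nu>(1,2)] curve.P_not_differentiable[OF \<nu>(1-3)]
    by (intro exI[of _ "curve.P \<nu>"]) auto
  have phases: "\<exists>\<xi>1 \<xi>2. minimisers d \<beta> \<alpha> a b \<nu> = {\<xi>1, \<xi>2} \<and>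
      total_density \<xi>1 > ereal (\<nu> / a) \<and> ereal (\<nu> / a) > total_density \<xi>2"
    using \<nu>(6) dens by blast
  have mem: "\<nu> \<in> {mu_tang d \<beta> \<alpha> a b<..<mu_p d \<beta> \<alpha> a b}"
    using \<nu>(1,2) by (simp add: mu_p_eq mu_tang_eq)
  have "\<exists>!\<mu>s. \<mu>s \<in> {mu_tang d \<beta> \<alpha> a b<..<mu_p d \<beta> \<alpha> a b} \<and> single_transition_at d \<beta> \<alpha> a b \<mu>s"
    using mem st unique by (intro ex1I[of _ \<nu>]) blast+
  moreover have "\<forall>\<mu>s \<in> {mu_tang d \<beta> \<alpha> a b<..<mu_p d \<beta> \<alpha> a b}.
      single_transition_at d \<beta> \<alpha> a b \<mu>s \<longrightarrow>
        (\<exists>\<phi>::real \<Rightarrow> real.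
           (\<forall>\<mu>. ereal (\<phi> \<mu>) = (INF x\<in>l1_plus. F d \<beta> \<alpha> a b \<mu> x)) \<and>
           \<phi> differentiable_on ({..<\<mu>s} \<union> {\<mu>s<..}) \<and>
           (\<forall>U. open U \<and> \<mu>s \<in> U \<longrightarrow> \<not> \<phi> differentiable_on U)) \<and>
        (\<exists>\<xi>1 \<xi>2. minimisers d \<beta> \<alpha> a b \<mu>s = {\<xi>1, \<xi>2} \<and>
           total_density \<xi>1 > ereal (\<mu>s / a) \<and> ereal (\<mu>s / a) > total_density \<xi>2)"
  proof (intro ballI impI)
    fix \<mu>s assume "single_transition_at d \<beta> \<alpha> a b \<mu>s"
    then have eq: "\<mu>s = \<nu>" by (rule unique)
    show "(\<exists>\<phi>::real \<Rightarrow> real.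
           (\<forall>\<mu>. ereal (\<phi> \<mu>) = (INF x\<in>l1_plus. F d \<beta> \<alpha> a b \<mu> x)) \<and>
           \<phi> differentiable_on ({..<\<mu>s} \<union> {\<mu>s<..}) \<and>
           (\<forall>U. open U \<and> \<mu>s \<in> U \<longrightarrow> \<not> \<phi> differentiable_on U)) \<and>
        (\<exists>\<xi>1 \<xi>2. minimisers d \<beta> \<alpha> a b \<mu>s = {\<xi>1, \<xi>2} \<and>
           total_density \<xi>1 > ereal (\<mu>s / a) \<and> ereal (\<mu>s / a) > total_density \<xi>2)"
      unfolding eq by (rule conjI[OF pressure phases])
  qed
  ultimately show ?thesis by (rule conjI)
qed

end

theorem theorem3p14:
  fixes d :: nat and \<beta> \<alpha> a b :: real
  assumes "d \<ge> 3" and "\<beta> > 0" and "\<alpha> \<le> 0" and "a > 0" and "0 < b"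
    and "b \<le> 1 / (exp 1 * \<beta> * q d \<beta> \<alpha> 1)"
    and "b < min a (inverse (\<beta> * q d \<beta> \<alpha> 1) * exp (- \<beta> * mu_p d \<beta> \<alpha> a b / a))"
  shows "(\<forall>\<mu>\<le>mu_p d \<beta> \<alpha> a b.
            left_slope_gt_one (h_tilde d \<beta> \<alpha> a b) 0
              \<longleftrightarrow> left_slope_gt_one (g0 d \<beta> \<alpha> a b \<mu>) (\<mu> / a)) \<and>
         ((d \<ge> 5 \<or> \<alpha> < 0 \<longrightarrow> left_slope_gt_one (h_tilde d \<beta> \<alpha> a b) 0) \<longrightarrow>
           (\<exists>!\<mu>s. \<mu>s \<in> {mu_tang d \<beta> \<alpha> a b<..<mu_p d \<beta> \<alpha> a b}
                   \<and> single_transition_at d \<beta> \<alpha> a b \<mu>s) \<and>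
           (\<forall>\<mu>s \<in> {mu_tang d \<beta> \<alpha> a b<..<mu_p d \<beta> \<alpha> a b}.
              single_transition_at d \<beta> \<alpha> a b \<mu>s \<longrightarrow>
                (\<exists>\<phi>::real \<Rightarrow> real.
                   (\<forall>\<mu>. ereal (\<phi> \<mu>) = (INF x\<in>l1_plus. F d \<beta> \<alpha> a b \<mu> x)) \<and>
                   \<phi> differentiable_on ({..<\<mu>s} \<union> {\<mu>s<..}) \<and>
                   (\<forall>U. open U \<and> \<mu>s \<in> U \<longrightarrow> \<not> \<phi> differentiable_on U)) \<and>
                (\<exists>\<xi>1 \<xi>2. minimisers d \<beta> \<alpha> a b \<mu>s = {\<xi>1, \<xi>2} \<and>
                   total_density \<xi>1 > ereal (\<mu>s / a) \<and> ereal (\<mu>s / a) > total_density \<xi>2)))"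
proof (intro conjI allI impI)
  interpret hyl_gas d \<beta> \<alpha> a b
    using assms by unfold_locales auto
  show "left_slope_gt_one (h_tilde d \<beta> \<alpha> a b) 0 \<longleftrightarrow> left_slope_gt_one (g0 d \<beta> \<alpha> a b \<mu>) (\<mu> / a)" for \<mu>
    by (rule left_slope_shift) (rule g0_eq_h_tilde[OF assms(4)])
  assume slope: "d \<ge> 5 \<or> \<alpha> < 0 \<longrightarrow> left_slope_gt_one (h_tilde d \<beta> \<alpha> a b) 0"
  interpret hyl_transition d \<beta> \<alpha> a b
  proof
    show "\<exists>s>0. a * N s + (a - b) / b * s < a * N 0"
    proof (cases "d \<ge> 5 \<or> \<alpha> < 0")
      case True
      then show ?thesis using slope steep_of_left_slope by blast
    next
      case False
      then show ?thesis using steep_of_low_dimension assms(3) by auto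
    qed
  qed
  show "\<exists>!\<mu>s. \<mu>s \<in> {mu_tang d \<beta> \<alpha> a b<..<mu_p d \<beta> \<alpha> a b} \<and> single_transition_at d \<beta> \<alpha> a b \<mu>s"
    using unique_transition by blast
  show "\<forall>\<mu>s \<in> {mu_tang d \<beta> \<alpha> a b<..<mu_p d \<beta> \<alpha> a b}.
              single_transition_at d \<beta> \<alpha> a b \<mu>s \<longrightarrow>
                (\<exists>\<phi>::real \<Rightarrow> real.
                   (\<forall>\<mu>. ereal (\<phi> \<mu>) = (INF x\<in>l1_plus. F d \<beta> \<alpha> a b \<mu> x)) \<and>
                   \<phi> differentiable_on ({..<\<mu>s} \<union> {\<mu>s<..}) \<and>
                   (\<forall>U. open U \<and> \<mu>s \<in> U \<longrightarrow> \<not> \<phi> differentiable_on U)) \<and>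
                (\<exists>\<xi>1 \<xi>2. minimisers d \<beta> \<alpha> a b \<mu>s = {\<xi>1, \<xi>2} \<and>
                   total_density \<xi>1 > ereal (\<mu>s / a) \<and> ereal (\<mu>s / a) > total_density \<xi>2)"
    using unique_transition by (rule conjunct2)
qed

end
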